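(* Let $a,b,c,d\in\mathbb{Z}$, put $N=a^2+b^2+c^2+d^2$, and let $m,n\in\mathbb{N}$ be such that $Nm-n^4$ is non-negative and not of the form $4^r(8s+7)$ for any $r,s\in\mathbb{N}$. If $N\in\{1,3,5,7,11,15,23\}$, or $N=2^g$, or $N=3\cdot 2^g$, or $N=7\cdot 2^g$ for some odd positive integer $g$, then the system $$\begin{cases} m = x^2+y^2+z^2+t^2\\ n^2 = ax+by+cz+dt\end{cases}$$ has a solution $(x,y,z,t)\in\mathbb{Z}^4$.
   Context: Here $\mathbb{N}=\{0,1,2,\ldots\}$. The number $N$ is the norm of the Lipschitz integer (quaternion with integer coefficients) $\zeta=a+bi+cj+dk$. *)

theory Defs
  imports Complex_Main
begin

end

theory Submission
  imports Defs "HOL-Number_Theory.Number_Theory" "HOL-Analysis.Harmonic_Numbers"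
    "HOL-Computational_Algebra.Squarefree"
begin

text \<open>By the three-square theorem \<open>N m - n\<^sup>4 = x\<^sup>2 + y\<^sup>2 + z\<^sup>2\<close>, so the Lipschitz quaternion
  \<open>\<delta> = n\<^sup>2 + x i + y j + z k\<close> has norm \<open>N m\<close>. A Lagrange descent gives \<open>\<delta> = \<pi> \<gamma>\<close> with \<open>\<pi>\<close> of norm \<open>N\<close> and
  \<open>\<gamma>\<close> of norm \<open>m\<close>, and the real part of this product expresses \<open>n\<^sup>2\<close> linearly in the coordinates of \<open>\<gamma>\<close>
  with the coordinates of \<open>\<pi>\<close> as coefficients. The admissible \<open>N\<close> have only one representation as a
  sum of four squares up to order and signs, so \<open>\<pi>\<close> may be exchanged for \<open>(a, b, c, d)\<close>.

  The three-square theorem is proved without Dirichlet's theorem on primes. If \<open>-U\<close> is a square modulo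
  \<open>n\<close> and \<open>-n\<close> is a square modulo \<open>U\<close>, for coprime positive \<open>U\<close> and \<open>n\<close>, then \<open>n\<close> is a value of a positive ternary form
  of determinant 1, which reduces to a sum of three squares. A suitable \<open>U\<close> need not be
  prime: it is enough that its prime factors \<open>q\<close> satisfy \<open>(-n/q) = 1\<close> and that \<open>(U/p)\<close> is prescribed for
  the odd primes \<open>p\<close> dividing \<open>n\<close>. Its existence follows by comparing, for \<open>r(v) = \<Sum>d|v. (-n/d)\<close>, the
  sum of \<open>r(v) / sqrt v\<close>, which diverges because of the squares \<open>v\<close>, with the twisted sums of
  \<open>\<psi>(v) r(v) / sqrt v\<close>, which are bounded by the hyperbola method.\<close>

section \<open>Unimodular ternary quadratic forms\<close>

lemma balanced_residue:
  fixes q p :: int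
  assumes "p > 0"
  shows "\<exists>l. \<bar>2 * (q + l * p)\<bar> \<le> p"
proof -
  define r where "r = q mod p"
  have r: "0 \<le> r" "r < p" "q = r + (q div p) * p"
    using assms by (auto simp: r_def)
  show ?thesis
  proof (cases "2 * r \<le> p")
    case True
    with r show ?thesis by (intro exI[of _ "- (q div p)"]) (auto simp: algebra_simps)
  next
    case False
    with r show ?thesis by (intro exI[of _ "- (q div p) - 1"]) (auto simp: algebra_simps)
  qed
qed

text \<open>The coefficients are the upper triangle, read row by row, of the symmetric matrix with
  rows (a, b, c), (b, d, e), (c, e, f); \<open>ternary_det\<close> is its determinant.\<close>

definition ternary_form :: "int \<Rightarrow> int \<Rightarrow> int \<Rightarrow> int \<Rightarrow> int \<Rightarrow> int \<Rightarrow> int \<Rightarrow> int \<Rightarrow> int \<Rightarrow> int" where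
  "ternary_form a b c d e f x y z =
     a * x^2 + d * y^2 + f * z^2 + 2 * b * x * y + 2 * c * x * z + 2 * e * y * z"

definition ternary_det :: "int \<Rightarrow> int \<Rightarrow> int \<Rightarrow> int \<Rightarrow> int \<Rightarrow> int \<Rightarrow> int" where
  "ternary_det a b c d e f = a * d * f + 2 * b * c * e - a * e^2 - d * c^2 - f * b^2"

lemma ternary_shift2:
  "ternary_form a b c d e f x y z =
   ternary_form a (b + k * a) c (d + 2 * k * b + k^2 * a) (e + k * c) f (x - k * y) y z"
  "ternary_det a (b + k * a) c (d + 2 * k * b + k^2 * a) (e + k * c) f = ternary_det a b c d e f"
  by (simp_all add: ternary_form_def ternary_det_def algebra_simps power2_eq_square)

lemma ternary_shift3:
  "ternary_form a b c d e f x y z =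
   ternary_form a b (c + l * b) d (e + l * d) (f + 2 * l * e + l^2 * d) x (y - l * z) z"
  "ternary_det a b (c + l * b) d (e + l * d) (f + 2 * l * e + l^2 * d) = ternary_det a b c d e f"
  by (simp_all add: ternary_form_def ternary_det_def algebra_simps power2_eq_square)

lemma ternary_swap12:
  "ternary_form a b c d e f x y z = ternary_form d b e a c f y x z"
  "ternary_det d b e a c f = ternary_det a b c d e f"
  by (simp_all add: ternary_form_def ternary_det_def algebra_simps)

lemma ternary_swap23:
  "ternary_form a b c d e f x y z = ternary_form a c b f e d x z y"
  "ternary_det a c b f e d = ternary_det a b c d e f"
  by (simp_all add: ternary_form_def ternary_det_def algebra_simps)

text \<open>Hermite's bounds: (a, b, d) and (p, q, r) are reduced binary forms of determinants p and
  a. This gives 3 a^2 \<le> 4 p and 3 p^2 \<le> 4 a; eliminating p gives 27 a^3 \<le> 64, so a = 1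
  and then p = 1.\<close>

lemma reduced_ternary_bounds:
  fixes a b d p q r :: int
  assumes pos: "a > 0" "p > 0" and p: "p = a * d - b^2" and pr: "p * r - q^2 = a"
    and red: "\<bar>2 * b\<bar> \<le> a" "\<bar>2 * q\<bar> \<le> p" "a \<le> d" "p \<le> r"
  shows "a = 1" "p = 1" "b = 0" "q = 0" "r = 1"
proof -
  have "(2 * b)^2 \<le> a^2" "(2 * q)^2 \<le> p^2"
    using power_mono[OF red(1), of 2] power_mono[OF red(2), of 2] by simp_all
  moreover have "a^2 \<le> a * d" "p^2 \<le> p * r"
    using red pos by (auto simp: power2_eq_square)
  ultimately have 1: "3 * a^2 \<le> 4 * p" "3 * p^2 \<le> 4 * a"
    using p pr by (auto simp: power_mult_distrib)
  have "a < 2"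
  proof (rule ccontr)
    assume "\<not> a < 2"
    then have a2: "a \<ge> 2" by simp
    have "(3 * a^2)^2 \<le> (4 * p)^2"
      using 1(1) pos by (intro power_mono) auto
    then have "27 * (a * a^3) \<le> 48 * p^2" by (simp add: power_mult_distrib power2_eq_square power3_eq_cube)
    with 1 have "a * (27 * a^3) \<le> a * 64" by simp
    then have "27 * a^3 \<le> 64" using pos by simp
    moreover have "a^3 \<ge> 2^3" using a2 by (intro power_mono) auto
    ultimately show False by simp
  qed
  with pos show a: "a = 1" by simp
  have "p < 2"
  proof (rule ccontr)
    assume "\<not> p < 2"
    then have "p^2 \<ge> 2^2" by (intro power_mono) auto
    with 1 a show False by simp
  qed
  with pos show "p = 1" by simp
  with a red show b: "b = 0" and q: "q = 0" by auto
  with a \<open>p = 1\<close> pr show "r = 1" by simp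
qed

text \<open>Reduction, by induction on (a, a d - b^2) in lexicographic order. Two shifts balance b
  and the minor q. Then swapping the first two variables lowers a, or swapping the last two keeps a
  and lowers a d - b^2, or the form is reduced.\<close>

lemma unimodular_ternary_sum_three_squares:
  assumes "a > 0" "a * d - b^2 > 0" "ternary_det a b c d e f = 1"
  shows "\<exists>X Y Z. ternary_form a b c d e f x y z = X^2 + Y^2 + Z^2"
  using assms
proof (induction "(nat a, nat (a * d - b^2))" arbitrary: a b c d e f x y z
    rule: wf_induct_rule[OF wf_lex_prod[OF wf_less_than wf_less_than]])
  case (1 a b d c e f x y z)
  define p where "p = a * d - b^2"
  have p: "p > 0" using 1(3) by (simp add: p_def)
  \<comment> \<open>The shift by \<open>l\<close> changes the minor a e - b c by l p. The later
    shift by \<open>k\<close> leaves that minor alone, so the two balancing steps do not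
    interfere.\<close>
  obtain l where l: "\<bar>2 * (a * e - b * c + l * p)\<bar> \<le> p"
    using balanced_residue[OF p] by blast
  define c1 e1 f1 where "c1 = c + l * b" and "e1 = e + l * d" and "f1 = f + 2 * l * e + l^2 * d"
  have q1: "\<bar>2 * (a * e1 - b * c1)\<bar> \<le> p"
    using l by (simp add: c1_def e1_def p_def algebra_simps power2_eq_square)
  obtain k where k: "\<bar>2 * (b + k * a)\<bar> \<le> a"
    using balanced_residue[OF 1(2)] by blast
  define b2 d2 e2 where "b2 = b + k * a" and "d2 = d + 2 * k * b + k^2 * a" and "e2 = e1 + k * c1"
  define y1 x1 where "y1 = y - l * z" and "x1 = x - k * y1"
  have form: "ternary_form a b c d e f x y z = ternary_form a b2 c1 d2 e2 f1 x1 y1 z"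
    unfolding ternary_shift3(1)[of a b c d e f x y z l] c1_def[symmetric] e1_def[symmetric]
      f1_def[symmetric] y1_def[symmetric]
    unfolding ternary_shift2(1)[of a b c1 d e1 f1 x y1 z k] b2_def d2_def e2_def x1_def ..
  have det: "ternary_det a b2 c1 d2 e2 f1 = 1"
    using 1(4) ternary_shift3(2)[of a b c l d e f] ternary_shift2(2)[of a b k c1 d e1 f1]
    by (simp add: c1_def e1_def f1_def b2_def d2_def e2_def)
  have p2: "p = a * d2 - b2^2"
    unfolding p_def b2_def d2_def by (simp add: algebra_simps power2_eq_square)
  define q where "q = a * e2 - b2 * c1"
  define r where "r = a * f1 - c1^2"
  have q: "\<bar>2 * q\<bar> \<le> p"
    using q1 by (simp add: q_def e2_def b2_def algebra_simps)
  \<comment> \<open>Sylvester's identity for the minors that border the entry a. As the determinant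
    is 1, (p, q, r) is a binary form of determinant a.\<close>
  have "p * r - q^2 = a * ternary_det a b2 c1 d2 e2 f1"
    unfolding p2 q_def r_def ternary_det_def by (simp add: algebra_simps power2_eq_square)
  then have pr: "p * r - q^2 = a" using det by simp
  have b2: "\<bar>2 * b2\<bar> \<le> a" using k by (simp add: b2_def)
  have "p * r > 0" using pr 1(2) zero_le_power2[of q] by linarith
  then have r0: "r > 0" using p by (simp add: zero_less_mult_iff)
  have "a * d2 > 0" using p2 p zero_le_power2[of b2] by linarith
  then have d20: "d2 > 0" using 1(2) by (simp add: zero_less_mult_iff)
  consider "d2 < a" | "r < p" | "a \<le> d2" "p \<le> r" by linarith
  then show ?case
  proof cases
    case 1
    have "\<exists>X Y Z. ternary_form d2 b2 e2 a c1 f1 y1 x1 z = X^2 + Y^2 + Z^2"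
      using d20 1 p p2 det \<open>a > 0\<close>
      by (intro "1.hyps") (auto simp: mult.commute ternary_swap12(2))
    then show ?thesis by (simp only: form ternary_swap12(1)[of a b2 c1 d2 e2 f1 x1 y1 z])
  next
    case 2
    have "\<exists>X Y Z. ternary_form a c1 b2 f1 e2 d2 x1 z y1 = X^2 + Y^2 + Z^2"
      using 2 r0 p det \<open>a > 0\<close>
      by (intro "1.hyps") (auto simp: ternary_swap23(2) r_def p_def)
    then show ?thesis by (simp only: form ternary_swap23(1)[of a b2 c1 d2 e2 f1 x1 y1 z])
  next
    case 3
    note red = reduced_ternary_bounds[OF \<open>a > 0\<close> p p2 pr b2 q 3]
    have "d2 = 1" "e2 = 0" "f1 = 1 + c1^2"
      using red p2 by (simp_all add: q_def r_def)
    with red have "ternary_form a b2 c1 d2 e2 f1 x1 y1 z = (x1 + c1 * z)^2 + y1^2 + z^2"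
      by (simp add: ternary_form_def algebra_simps power2_eq_square)
    then show ?thesis unfolding form by blast
  qed
qed

text \<open>The matrix with n d - \<alpha>^2 = U, n e - \<alpha> \<beta> = C and n f - \<beta>^2 =
  W, where U W - C^2 = n, has determinant 1, and its form takes the value n at (1, 0, 0). The
  residue conditions make d, e and f integral.\<close>

lemma sum_three_squares_of_residues:
  fixes n U \<alpha> C :: int
  assumes "n > 0" "U > 0" "coprime U n" and \<alpha>: "n dvd \<alpha>^2 + U" and C: "U dvd C^2 + n"
  shows "\<exists>x y z. n = x^2 + y^2 + z^2"
proof -
  obtain W where W: "U * W = C^2 + n" using C by (metis dvdE)
  have "coprime \<alpha> n"
  proof (rule coprimeI)
    fix k assume "k dvd \<alpha>" "k dvd n"
    then have "k dvd \<alpha>^2 + U" "k dvd \<alpha>^2" using \<alpha> by (auto intro: dvd_trans simp: power2_eq_square)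
    then have "k dvd U" by (simp add: dvd_add_right_iff)
    with \<open>k dvd n\<close> assms(3) show "is_unit k" using coprime_common_divisor by blast
  qed
  then obtain s where s: "[\<alpha> * s = 1] (mod n)" using cong_solve_coprime_int by blast
  \<comment> \<open>Chosen to solve \<alpha> \<beta> = -C modulo n, which makes e integral.\<close>
  define \<beta> where "\<beta> = - C * s"
  have "[\<alpha> * \<beta> + C = - C * (\<alpha> * s) + C] (mod n)" by (simp add: \<beta>_def algebra_simps)
  also have "[- C * (\<alpha> * s) + C = - C * 1 + C] (mod n)"
    using s by (intro cong_add cong_mult cong_refl)
  finally have dC: "n dvd \<alpha> * \<beta> + C" by (simp add: cong_0_iff)
  have "n dvd \<alpha>^2 * (\<beta>^2 + W)"
  proof -
    have "\<alpha>^2 * (\<beta>^2 + W) = (\<alpha> * \<beta> + C) * (\<alpha> * \<beta> - C) + (C^2 - U * W) + (\<alpha>^2 + U) * W"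
      by (simp add: algebra_simps power2_eq_square)
    also have "n dvd \<dots>" using dC \<alpha> W by (intro dvd_add) auto
    finally show ?thesis .
  qed
  then have dW: "n dvd \<beta>^2 + W" using \<open>coprime \<alpha> n\<close>
    by (simp add: coprime_dvd_mult_right_iff coprime_commute)
  obtain d e f where def: "n * d = \<alpha>^2 + U" "n * e = \<alpha> * \<beta> + C" "n * f = \<beta>^2 + W"
    using \<alpha> dC dW unfolding dvd_def by metis
  have "n * ternary_det n \<alpha> \<beta> d e f = (n * d - \<alpha>^2) * (n * f - \<beta>^2) - (n * e - \<alpha> * \<beta>)^2"
    unfolding ternary_det_def by (simp add: algebra_simps power2_eq_square)
  also have "\<dots> = n * 1" using def W by simp
  finally have "ternary_det n \<alpha> \<beta> d e f = 1" using assms(1) by simp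
  then have "\<exists>x y z. ternary_form n \<alpha> \<beta> d e f 1 0 0 = x^2 + y^2 + z^2"
    using assms def by (intro unimodular_ternary_sum_three_squares) auto
  then show ?thesis by (simp add: ternary_form_def)
qed

section \<open>Factorisation of Lipschitz quaternions\<close>

datatype lipschitz = Lip int int int int

fun qmul :: "lipschitz \<Rightarrow> lipschitz \<Rightarrow> lipschitz" (infixl "\<star>" 70) where
  "Lip a b c d \<star> Lip x y z t =
     Lip (a*x - b*y - c*z - d*t) (a*y + b*x + c*t - d*z) (a*z - b*t + c*x + d*y) (a*t + b*z - c*y + d*x)"

fun qcnj :: "lipschitz \<Rightarrow> lipschitz" where
  "qcnj (Lip a b c d) = Lip a (-b) (-c) (-d)"

fun qnorm :: "lipschitz \<Rightarrow> int" where
  "qnorm (Lip a b c d) = a^2 + b^2 + c^2 + d^2"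

fun qdvd :: "int \<Rightarrow> lipschitz \<Rightarrow> bool" where
  "qdvd n (Lip a b c d) \<longleftrightarrow> n dvd a \<and> n dvd b \<and> n dvd c \<and> n dvd d"

fun qadd :: "lipschitz \<Rightarrow> lipschitz \<Rightarrow> lipschitz" (infixl "\<boxplus>" 65) where
  "Lip a b c d \<boxplus> Lip x y z t = Lip (a + x) (b + y) (c + z) (d + t)"

abbreviation qint :: "int \<Rightarrow> lipschitz" where
  "qint n \<equiv> Lip n 0 0 0"

section \<open>Conjugation, norm and divisibility by integers\<close>

lemma qmul_assoc: "(x \<star> y) \<star> z = x \<star> (y \<star> z)"
  by (cases x; cases y; cases z) (simp add: algebra_simps)

lemma qcnj_mul: "qcnj (x \<star> y) = qcnj y \<star> qcnj x"
  by (cases x; cases y) (simp add: algebra_simps)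

lemma qcnj_cnj [simp]: "qcnj (qcnj x) = x"
  by (cases x) simp

lemma qnorm_mul: "qnorm (x \<star> y) = qnorm x * qnorm y"
  by (cases x; cases y) (simp add: algebra_simps power2_eq_square)

lemma qnorm_cnj [simp]: "qnorm (qcnj x) = qnorm x"
  by (cases x) simp

lemma qmul_cnj: "x \<star> qcnj x = qint (qnorm x)" "qcnj x \<star> x = qint (qnorm x)"
  by (cases x; simp add: algebra_simps power2_eq_square)+

lemma qint_commute: "qint n \<star> x = x \<star> qint n"
  by (cases x) (simp add: algebra_simps)

lemma qint_cancel: "n \<noteq> 0 \<Longrightarrow> qint n \<star> x = qint n \<star> y \<Longrightarrow> x = y"
  by (cases x; cases y) simp

lemma qdvd_iff: "qdvd n x \<longleftrightarrow> (\<exists>y. x = qint n \<star> y)"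
proof
  assume "qdvd n x"
  then show "\<exists>y. x = qint n \<star> y"
  proof (cases x)
    case (Lip a b c d)
    with \<open>qdvd n x\<close> obtain a' b' c' d' where "a = n * a'" "b = n * b'" "c = n * c'" "d = n * d'"
      by (auto elim!: dvdE)
    with Lip have "x = qint n \<star> Lip a' b' c' d'" by simp
    then show ?thesis ..
  qed
next
  assume "\<exists>y. x = qint n \<star> y"
  then obtain y where "x = qint n \<star> y" ..
  then show "qdvd n x" by (cases y) simp
qed

lemma qdvd_mul_left: "qdvd n y \<Longrightarrow> qdvd n (x \<star> y)"
  unfolding qdvd_iff by (metis qint_commute qmul_assoc)

lemma qdvd_coprime: "coprime s n \<Longrightarrow> qdvd n (qint s \<star> x) \<Longrightarrow> qdvd n x"
  by (cases x) (auto simp: coprime_dvd_mult_right_iff coprime_commute)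

lemma qdvd_norm: "qdvd n x \<Longrightarrow> n^2 dvd qnorm x"
  by (auto simp: qdvd_iff qnorm_mul)

text \<open>Carries the invariant of the descent from \<open>\<rho>\<close> to
  \<open>\<tau>\<close>: conjugation moves \<open>\<kappa>\<close> to the far left, and
  \<open>s\<close> is invertible modulo \<open>p\<close>.\<close>

lemma qdvd_descend:
  assumes "qint s \<star> \<tau> = \<rho> \<star> \<kappa>" "coprime s p" "qdvd p (qcnj \<rho> \<star> \<delta>)"
  shows "qdvd p (qcnj \<tau> \<star> \<delta>)"
proof (rule qdvd_coprime[OF assms(2)])
  have "qint s \<star> (qcnj \<tau> \<star> \<delta>) = qcnj (qint s \<star> \<tau>) \<star> \<delta>"
    by (simp add: qcnj_mul qmul_assoc[symmetric] qint_commute)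
  also have "\<dots> = qcnj \<kappa> \<star> (qcnj \<rho> \<star> \<delta>)"
    by (simp add: assms(1) qcnj_mul qmul_assoc)
  finally show "qdvd p (qint s \<star> (qcnj \<tau> \<star> \<delta>))"
    using qdvd_mul_left[OF assms(3)] by simp
qed

text \<open>The coordinates can be paired so that both pair sums are even; multiplication by 1 + i,
  1 + j or 1 + k then makes all four coordinates even.\<close>

lemma halve_even_norm:
  assumes "even (qnorm x)"
  obtains u y where "qnorm u = 2" "qint 2 \<star> y = x \<star> u"
proof (cases x)
  case (Lip a b c d)
  note result = that
  have par: "even (a + b + c + d)" using assms Lip by auto
  have *: thesis if "even e1" "even e2" "even e3" "even e4" "qnorm u = 2" "x \<star> u = Lip e1 e2 e3 e4"
    for e1 e2 e3 e4 u
    using that by (intro result[of u "Lip (e1 div 2) (e2 div 2) (e3 div 2) (e4 div 2)"]) auto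
  consider "even (a + b)" "even (c + d)" | "even (a + c)" "even (b + d)" | "even (a + d)" "even (b + c)"
    using par by (auto)
  then show thesis
  proof cases
    case 1
    show thesis by (rule *[of "a - b" "a + b" "c + d" "d - c" "Lip 1 1 0 0"]) (use 1 Lip in \<open>auto simp: algebra_simps\<close>)
  next
    case 2
    show thesis by (rule *[of "a - c" "b - d" "a + c" "b + d" "Lip 1 0 1 0"]) (use 2 Lip in \<open>auto simp: algebra_simps\<close>)
  next
    case 3
    show thesis by (rule *[of "a - d" "b + c" "c - b" "a + d" "Lip 1 0 0 1"]) (use 3 Lip in \<open>auto simp: algebra_simps\<close>)
  qed
qed

section \<open>Reduction modulo an integer and the Lagrange descent\<close>

lemma qdvd_add_multiple: "qdvd n (x \<boxplus> qint n \<star> y) \<longleftrightarrow> qdvd n x"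
  by (cases x; cases y) (simp add: dvd_add_left_iff)

lemma qcnj_add_multiple: "qcnj (x \<boxplus> qint n \<star> y) = qcnj x \<boxplus> qint n \<star> qcnj y"
  by (cases x; cases y) simp

lemma qmul_add_multiple:
  "z \<star> (x \<boxplus> qint n \<star> y) = z \<star> x \<boxplus> qint n \<star> (z \<star> y)"
  "(x \<boxplus> qint n \<star> y) \<star> z = x \<star> z \<boxplus> qint n \<star> (y \<star> z)"
  by (cases x; cases y; cases z; simp add: algebra_simps)+

lemma qnorm_add_multiple: "n dvd qnorm (x \<boxplus> qint n \<star> y) \<longleftrightarrow> n dvd qnorm x"
proof (cases x; cases y)
  fix a b c d x' y' z' t'
  assume "x = Lip a b c d" "y = Lip x' y' z' t'"
  then have "qnorm (x \<boxplus> qint n \<star> y) =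
      n * (2 * (a * x' + b * y' + c * z' + d * t') + n * qnorm y) + qnorm x"
    by (simp add: algebra_simps power2_eq_square)
  then show ?thesis by (simp add: dvd_add_right_iff)
qed

text \<open>For odd m no residue has absolute value exactly m/2, so every coordinate can be brought
  strictly below m/2 in absolute value.\<close>

lemma balanced_quaternion:
  fixes m :: int
  assumes "m > 0" "odd m"
  shows "\<exists>\<kappa>. qnorm (\<rho> \<boxplus> qint m \<star> \<kappa>) < m^2"
proof (cases \<rho>)
  case (Lip a b c d)
  have "\<exists>l. 4 * (q + m * l)^2 < m^2" for q
  proof -
    obtain l where "\<bar>2 * (q + l * m)\<bar> \<le> m" using balanced_residue[OF assms(1)] by blast
    moreover have "\<bar>2 * (q + l * m)\<bar> \<noteq> m" 
    proof
      assume "\<bar>2 * (q + l * m)\<bar> = m"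
      moreover have "even \<bar>2 * (q + l * m)\<bar>" by simp
      ultimately show False using assms(2) by simp
    qed
    ultimately have "\<bar>2 * (q + l * m)\<bar> < m" by simp
    then have "\<bar>2 * (q + l * m)\<bar>^2 < m^2" by (intro power_strict_mono) auto
    moreover have "\<bar>2 * (q + l * m)\<bar>^2 = 4 * (q + m * l)^2"
      unfolding power2_abs power_mult_distrib by (simp add: mult.commute)
    ultimately show ?thesis by auto
  qed
  then obtain l1 l2 l3 l4 where
    "4 * (a + m * l1)^2 < m^2" "4 * (b + m * l2)^2 < m^2" "4 * (c + m * l3)^2 < m^2" "4 * (d + m * l4)^2 < m^2"
    by metis
  with Lip show ?thesis by (intro exI[of _ "Lip l1 l2 l3 l4"]) simp
qed

lemma qnorm_nonneg: "qnorm x \<ge> 0"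
  by (cases x) simp

lemma qnorm_eq_0: "qnorm x = 0 \<Longrightarrow> qdvd n x"
  by (cases x) (auto simp: add_nonneg_eq_0_iff)

text \<open>Descent on m. An even m is halved. For odd m, \<open>\<rho>\<close> is reduced modulo m
  to \<open>\<sigma>\<close> of norm m m' with m' < m; then
  \<open>\<rho> \<star> qcnj \<sigma>\<close> is m times a quaternion of norm p m'. Divisibility of
  \<open>qcnj \<rho> \<star> \<delta>\<close> by p survives both moves.\<close>

lemma prime_norm_descent:
  assumes "prime p" "odd p" "qnorm \<rho> = p * m" "0 < m" "m < p" "qdvd p (qcnj \<rho> \<star> \<delta>)"
  shows "\<exists>\<pi>. qnorm \<pi> = p \<and> qdvd p (qcnj \<pi> \<star> \<delta>)"
  using assms
proof (induction "nat m" arbitrary: m \<rho> rule: less_induct)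
  case less
  have p0: "p > 0" using less.prems(1) by (simp add: prime_gt_0_int)
  have cop: "coprime k p" if "0 < k" "k < p" for k
    using that less.prems(1) by (metis coprime_commute prime_imp_coprime zdvd_not_zless)
  consider "m = 1" | "even m" | "odd m" "m > 1" using less.prems by fastforce
  then show ?case
  proof cases
    case 1
    with less.prems show ?thesis by auto
  next
    case 2
    then obtain k where k: "m = 2 * k" by blast
    obtain u y where uy: "qnorm u = 2" "qint 2 \<star> y = \<rho> \<star> u"
      using halve_even_norm[of \<rho>] less.prems(3) 2 by auto
    have "qnorm (qint 2 \<star> y) = p * m * 2" by (simp add: uy qnorm_mul less.prems)
    then have "qnorm y = p * k" using k by (simp add: qnorm_mul)
    moreover have "qdvd p (qcnj y \<star> \<delta>)"
      using uy(2) by (rule qdvd_descend) (use less.prems 2 in \<open>auto intro!: cop\<close>)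
    ultimately show ?thesis
      using less.prems k by (intro less.hyps[of k y]) auto
  next
    case 3
    obtain \<kappa> where \<kappa>: "qnorm (\<rho> \<boxplus> qint m \<star> \<kappa>) < m^2"
      using balanced_quaternion[of m \<rho>] 3 by auto
    define \<sigma> where "\<sigma> = \<rho> \<boxplus> qint m \<star> \<kappa>"
    have "m dvd qnorm \<sigma>" unfolding \<sigma>_def qnorm_add_multiple using less.prems by simp
    then obtain m' where m': "qnorm \<sigma> = m * m'" ..
    have "m * m' < m * m" using \<kappa> m' by (simp add: \<sigma>_def power2_eq_square)
    then have "m' < m" using less.prems by simp
    \<comment> \<open>Otherwise m divides \<open>\<rho>\<close>, so m^2 divides p m, against 1 < m <
      p with p prime.\<close>
    have "qnorm \<sigma> \<noteq> 0"
    proof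
      assume "qnorm \<sigma> = 0"
      then have "qdvd m \<rho>" using qnorm_eq_0[of \<sigma> m] by (simp add: \<sigma>_def qdvd_add_multiple)
      from qdvd_norm[OF this] have "m dvd p"
        using less.prems by (simp add: power2_eq_square mult.commute)
      then show False using cop[of m] less.prems 3 by (simp add: coprime_absorb_left)
    qed
    then have "m * m' > 0" using qnorm_nonneg[of \<sigma>] m' by linarith
    then have "m' > 0" using less.prems by (simp add: zero_less_mult_iff)
    have "qdvd m (\<rho> \<star> qcnj \<sigma>)"
      unfolding \<sigma>_def qcnj_add_multiple qmul_add_multiple qdvd_add_multiple qmul_cnj
      using less.prems by simp
    then obtain \<tau> where \<tau>: "\<rho> \<star> qcnj \<sigma> = qint m \<star> \<tau>" unfolding qdvd_iff ..
    have "qnorm (qint m \<star> \<tau>) = p * m * (m * m')"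
      by (simp add: \<tau>[symmetric] qnorm_mul less.prems m')
    then have "qnorm \<tau> = p * m'" using less.prems by (simp add: qnorm_mul power2_eq_square)
    moreover have "qdvd p (qcnj \<tau> \<star> \<delta>)"
      using \<tau>[symmetric] by (rule qdvd_descend) (use less.prems in \<open>auto intro!: cop\<close>)
    ultimately show ?thesis
      using less.prems \<open>m' < m\<close> \<open>m' > 0\<close> by (intro less.hyps[of m' \<tau>]) auto
  qed
qed

definition splits_off :: "int \<Rightarrow> bool" where
  "splits_off n \<longleftrightarrow> (\<forall>\<delta>. n dvd qnorm \<delta> \<longrightarrow> (\<exists>\<pi> \<gamma>. qnorm \<pi> = n \<and> \<delta> = \<pi> \<star> \<gamma>))"

lemma left_factor_of_conjugate:
  assumes "qcnj \<pi> \<star> \<delta> = qint (qnorm \<pi>) \<star> \<gamma>" "qnorm \<pi> \<noteq> 0"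
  shows "\<delta> = \<pi> \<star> \<gamma>"
proof -
  have "qint (qnorm \<pi>) \<star> \<delta> = \<pi> \<star> (qcnj \<pi> \<star> \<delta>)" by (simp add: qmul_cnj(1)[symmetric] qmul_assoc)
  also have "\<dots> = qint (qnorm \<pi>) \<star> (\<pi> \<star> \<gamma>)" by (metis assms(1) qint_commute qmul_assoc)
  finally show ?thesis using qint_cancel assms(2) by blast
qed

text \<open>If p divides \<open>\<delta>\<close>, the given \<open>\<rho>\<close> is a left factor,
  because p = \<open>\<rho> \<star> qcnj \<rho>\<close>. Otherwise the descent starts from the
  residue of \<open>\<delta>\<close> modulo p, whose norm is p m with 0 < m < p.\<close>

lemma splits_off_odd_prime:
  assumes "prime p" "odd p" "qnorm \<rho> = p"
  shows "splits_off p"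
  unfolding splits_off_def
proof (intro allI impI)
  fix \<delta> assume \<delta>: "p dvd qnorm \<delta>"
  have p0: "p > 0" using assms(1) by (simp add: prime_gt_0_int)
  show "\<exists>\<pi> \<gamma>. qnorm \<pi> = p \<and> \<delta> = \<pi> \<star> \<gamma>"
  proof (cases "qdvd p \<delta>")
    case True
    then obtain y where "\<delta> = qint p \<star> y" unfolding qdvd_iff ..
    then have "\<delta> = \<rho> \<star> (qcnj \<rho> \<star> y)" by (simp add: qmul_assoc[symmetric] qmul_cnj assms)
    with assms show ?thesis by blast
  next
    case False
    obtain \<kappa> where \<kappa>: "qnorm (\<delta> \<boxplus> qint p \<star> \<kappa>) < p^2"
      using balanced_quaternion[of p \<delta>] p0 assms by auto
    define \<sigma> where "\<sigma> = \<delta> \<boxplus> qint p \<star> \<kappa>"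
    have "p dvd qnorm \<sigma>" unfolding \<sigma>_def qnorm_add_multiple using \<delta> .
    then obtain m where m: "qnorm \<sigma> = p * m" ..
    have "p * m < p * p" using \<kappa> m by (simp add: \<sigma>_def power2_eq_square)
    then have "m < p" using p0 by simp
    have "qnorm \<sigma> \<noteq> 0"
      using qnorm_eq_0[of \<sigma> p] False by (auto simp: \<sigma>_def qdvd_add_multiple)
    then have "p * m > 0" using qnorm_nonneg[of \<sigma>] m by linarith
    then have "m > 0" using p0 by (simp add: zero_less_mult_iff)
    \<comment> \<open>Modulo p the left factor is the conjugate of \<open>\<delta>\<close>, so the
      product is congruent to the norm of \<open>\<delta>\<close>.\<close>
    have "qdvd p (qcnj \<sigma> \<star> \<delta>)"
      unfolding \<sigma>_def qcnj_add_multiple qmul_add_multiple qdvd_add_multiple qmul_cnj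
      using \<delta> by simp
    then obtain \<pi> where \<pi>: "qnorm \<pi> = p" "qdvd p (qcnj \<pi> \<star> \<delta>)"
      using prime_norm_descent[OF assms(1,2) m] \<open>m > 0\<close> \<open>m < p\<close> by blast
    then show ?thesis
      using left_factor_of_conjugate[of \<pi> \<delta>] p0 unfolding qdvd_iff by auto
  qed
qed

text \<open>\<open>halve_even_norm\<close> multiplies on the right, so it is applied to the
  conjugate; conjugating back yields a left factor of norm 2.\<close>

lemma splits_off_2: "splits_off 2"
  unfolding splits_off_def
proof (intro allI impI)
  fix \<delta> assume "2 dvd qnorm \<delta>"
  then obtain u y where uy: "qnorm u = 2" "qint 2 \<star> y = qcnj \<delta> \<star> u"
    using halve_even_norm[of "qcnj \<delta>"] by auto
  have "qcnj u \<star> \<delta> = qint (qnorm u) \<star> qcnj y"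
    using arg_cong[OF uy(2), of qcnj] uy(1) by (simp add: qcnj_mul qint_commute)
  then have "\<delta> = u \<star> qcnj y" using left_factor_of_conjugate[of u \<delta> "qcnj y"] uy(1) by simp
  with uy(1) show "\<exists>\<pi> \<gamma>. qnorm \<pi> = 2 \<and> \<delta> = \<pi> \<star> \<gamma>" by blast
qed

lemma splits_off_1: "splits_off 1"
proof -
  have "qnorm (qint 1) = 1 \<and> \<delta> = qint 1 \<star> \<delta>" for \<delta> by (cases \<delta>) simp
  then show ?thesis unfolding splits_off_def by blast
qed

lemma splits_off_mult:
  assumes "splits_off m" "splits_off n" "m \<noteq> 0"
  shows "splits_off (m * n)"
  unfolding splits_off_def
proof (intro allI impI)
  fix \<delta> assume \<delta>: "m * n dvd qnorm \<delta>"
  then obtain \<pi> \<gamma> where 1: "qnorm \<pi> = m" "\<delta> = \<pi> \<star> \<gamma>"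
    using assms(1) unfolding splits_off_def by (meson dvd_mult_left)
  then have "n dvd qnorm \<gamma>" using \<delta> assms(3) by (simp add: qnorm_mul)
  then obtain \<pi>' \<gamma>' where "qnorm \<pi>' = n" "\<gamma> = \<pi>' \<star> \<gamma>'"
    using assms(2) unfolding splits_off_def by blast
  with 1 have "qnorm (\<pi> \<star> \<pi>') = m * n" "\<delta> = (\<pi> \<star> \<pi>') \<star> \<gamma>'"
    by (simp_all add: qnorm_mul qmul_assoc)
  then show "\<exists>\<pi> \<gamma>. qnorm \<pi> = m * n \<and> \<delta> = \<pi> \<star> \<gamma>" by blast
qed

lemma splits_off_power2: "splits_off (2 ^ g)"
  by (induction g) (simp_all add: splits_off_1 splits_off_2 splits_off_mult)

section \<open>Essentially unique sums of four squares\<close>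

text \<open>Insertion sort by adjacent transpositions.\<close>

lemma symmetric4_wlog_sorted:
  fixes P :: "int \<Rightarrow> int \<Rightarrow> int \<Rightarrow> int \<Rightarrow> bool"
  assumes swap: "\<And>a b c d. P a b c d \<Longrightarrow> P b a c d" "\<And>a b c d. P a b c d \<Longrightarrow> P a c b d"
      "\<And>a b c d. P a b c d \<Longrightarrow> P a b d c"
    and sorted: "\<And>a b c d. a \<ge> b \<Longrightarrow> b \<ge> c \<Longrightarrow> c \<ge> d \<Longrightarrow> P a b c d"
  shows "P a b c d"
proof -
  have tail3: "P a b c d" if "b \<ge> c" "c \<ge> d" for a b c d
  proof -
    consider "a \<ge> b" | "b \<ge> a" "a \<ge> c" | "c \<ge> a" "a \<ge> d" | "d \<ge> a" by linarith
    then show ?thesis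
    proof cases
      case 1
      with that show ?thesis by (intro sorted)
    next
      case 2
      with that show ?thesis by (intro swap(1)[of b a c d] sorted)
    next
      case 3
      with that show ?thesis by (intro swap(1)[of b a c d] swap(2)[of b c a d] sorted)
    next
      case 4
      with that show ?thesis
        by (intro swap(1)[of b a c d] swap(2)[of b c a d] swap(3)[of b c d a] sorted)
    qed
  qed
  have tail2: "P a b c d" if "c \<ge> d" for a b c d
  proof -
    consider "b \<ge> c" | "c \<ge> b" "b \<ge> d" | "d \<ge> b" by linarith
    then show ?thesis
    proof cases
      case 1
      with that show ?thesis by (intro tail3)
    next
      case 2
      with that show ?thesis by (intro swap(2)[of a c b d] tail3)
    next
      case 3
      with that show ?thesis by (intro swap(2)[of a c b d] swap(3)[of a c d b] tail3)
    qed
  qed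
  show ?thesis
  proof (cases "c \<ge> d")
    case True
    then show ?thesis by (rule tail2)
  next
    case False
    then show ?thesis by (intro swap(3)[of a b d c] tail2) simp
  qed
qed

definition linear_value :: "int \<Rightarrow> int \<Rightarrow> int \<Rightarrow> int \<Rightarrow> int \<Rightarrow> int \<Rightarrow> bool" where
  "linear_value m s a b c d \<longleftrightarrow>
     (\<exists>x y z t. m = x^2 + y^2 + z^2 + t^2 \<and> s = a * x + b * y + c * z + d * t)"

lemma linear_value_swap:
  "linear_value m s a b c d \<Longrightarrow> linear_value m s b a c d"
  "linear_value m s a b c d \<Longrightarrow> linear_value m s a c b d"
  "linear_value m s a b c d \<Longrightarrow> linear_value m s a b d c"
proof -
  assume "linear_value m s a b c d"
  then obtain x y z t where "m = x^2 + y^2 + z^2 + t^2" "s = a * x + b * y + c * z + d * t"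
    unfolding linear_value_def by blast
  then have "m = y^2 + x^2 + z^2 + t^2 \<and> s = b * y + a * x + c * z + d * t"
    "m = x^2 + z^2 + y^2 + t^2 \<and> s = a * x + c * z + b * y + d * t"
    "m = x^2 + y^2 + t^2 + z^2 \<and> s = a * x + b * y + d * t + c * z"
    by simp_all
  then show "linear_value m s b a c d" "linear_value m s a c b d" "linear_value m s a b d c"
    unfolding linear_value_def by blast+
qed

text \<open>A sign change of a coefficient is undone by changing the sign of its variable.\<close>

lemma linear_value_neg:
  assumes "linear_value m s a b c d" "\<bar>a'\<bar> = \<bar>a\<bar>" "\<bar>b'\<bar> = \<bar>b\<bar>" "\<bar>c'\<bar> = \<bar>c\<bar>" "\<bar>d'\<bar> = \<bar>d\<bar>"
  shows "linear_value m s a' b' c' d'"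
proof -
  have flip: "\<exists>x'. x'^2 = x^2 \<and> u' * x' = u * x" if "\<bar>u'\<bar> = \<bar>u\<bar>" for u u' x :: int
    using that by (cases "u' = u") (auto simp: abs_eq_iff intro: exI[of _ x] exI[of _ "-x"])
  obtain x y z t where "m = x^2 + y^2 + z^2 + t^2" "s = a * x + b * y + c * z + d * t"
    using assms(1) unfolding linear_value_def by blast
  then show ?thesis
    using flip[OF assms(2), of x] flip[OF assms(3), of y] flip[OF assms(4), of z] flip[OF assms(5), of t]
    unfolding linear_value_def by metis
qed

definition unique_four_squares :: "int \<Rightarrow> bool" where
  "unique_four_squares N \<longleftrightarrow> (\<forall>a b c d a' b' c' d'.
     a \<ge> b \<and> b \<ge> c \<and> c \<ge> d \<and> d \<ge> 0 \<and> a^2 + b^2 + c^2 + d^2 = N \<and>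
     a' \<ge> b' \<and> b' \<ge> c' \<and> c' \<ge> d' \<and> d' \<ge> 0 \<and> a'^2 + b'^2 + c'^2 + d'^2 = N \<longrightarrow>
     a = a' \<and> b = b' \<and> c = c' \<and> d = d')"

lemma unique_four_squaresI:
  assumes "\<And>a b c d. a \<ge> b \<Longrightarrow> b \<ge> c \<Longrightarrow> c \<ge> d \<Longrightarrow> d \<ge> 0 \<Longrightarrow> a^2 + b^2 + c^2 + d^2 = N \<Longrightarrow>
     a = p \<and> b = q \<and> c = r \<and> d = s"
  shows "unique_four_squares N"
  unfolding unique_four_squares_def
proof (intro allI impI, elim conjE)
  fix a b c d a' b' c' d' :: int
  assume *: "a \<ge> b" "b \<ge> c" "c \<ge> d" "d \<ge> 0" "a^2 + b^2 + c^2 + d^2 = N"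
     "a' \<ge> b'" "b' \<ge> c'" "c' \<ge> d'" "d' \<ge> 0" "a'^2 + b'^2 + c'^2 + d'^2 = N"
  show "a = a' \<and> b = b' \<and> c = c' \<and> d = d'"
    using assms[OF *(1-5)] assms[OF *(6-10)] by simp
qed

text \<open>As N < 25, no coordinate exceeds 4, which leaves a finite search.\<close>

lemma unique_four_squares_check:
  assumes "N \<le> 23"
    and "\<forall>a\<in>{0, 1, 2, 3, 4}. \<forall>b\<in>{0, 1, 2, 3, 4}. \<forall>c\<in>{0, 1, 2, 3, 4}. \<forall>d\<in>{0, 1, 2, 3, 4}.
      b \<le> a \<longrightarrow> c \<le> b \<longrightarrow> d \<le> c \<longrightarrow> a^2 + b^2 + c^2 + d^2 = N \<longrightarrow>
      a = p \<and> b = q \<and> c = r \<and> d = s"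
  shows "unique_four_squares N"
proof (rule unique_four_squaresI[of N p q r s])
  fix a b c d :: int
  assume *: "a \<ge> b" "b \<ge> c" "c \<ge> d" "d \<ge> 0" "a^2 + b^2 + c^2 + d^2 = N"
  have "a < 5"
  proof (rule ccontr)
    assume "\<not> a < 5"
    then have "a^2 \<ge> 25" using power_mono[of 5 a 2] by simp
    with *(5) assms(1) zero_le_power2[of b] zero_le_power2[of c] zero_le_power2[of d]
    show False by linarith
  qed
  then have "a \<in> {0, 1, 2, 3, 4}" "b \<in> {0, 1, 2, 3, 4}" "c \<in> {0, 1, 2, 3, 4}" "d \<in> {0, 1, 2, 3, 4}"
    using * by auto
  then show "a = p \<and> b = q \<and> c = r \<and> d = s"
    using * assms(2) by blast
qed

lemma unique_four_squares_small:
  "unique_four_squares 1" "unique_four_squares 3" "unique_four_squares 5" "unique_four_squares 7"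
  "unique_four_squares 11" "unique_four_squares 15" "unique_four_squares 23"
  "unique_four_squares 2" "unique_four_squares 6" "unique_four_squares 14"
  subgoal by (rule unique_four_squares_check[of _ 1 0 0 0]) simp_all
  subgoal by (rule unique_four_squares_check[of _ 1 1 1 0]) simp_all
  subgoal by (rule unique_four_squares_check[of _ 2 1 0 0]) simp_all
  subgoal by (rule unique_four_squares_check[of _ 2 1 1 1]) simp_all
  subgoal by (rule unique_four_squares_check[of _ 3 1 1 0]) simp_all
  subgoal by (rule unique_four_squares_check[of _ 3 2 1 1]) simp_all
  subgoal by (rule unique_four_squares_check[of _ 3 3 2 1]) simp_all
  subgoal by (rule unique_four_squares_check[of _ 1 1 0 0]) simp_all
  subgoal by (rule unique_four_squares_check[of _ 2 1 1 0]) simp_all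
  subgoal by (rule unique_four_squares_check[of _ 3 2 1 0]) simp_all
  done

section \<open>Passing from N to 4 N\<close>

lemma square_mod_8:
  fixes x :: int
  shows "x^2 mod 8 = (if odd x then 1 else if 4 dvd x then 0 else 4)"
proof -
  have "x mod 8 = 0 \<or> x mod 8 = 1 \<or> x mod 8 = 2 \<or> x mod 8 = 3 \<or> x mod 8 = 4 \<or> x mod 8 = 5 \<or>
      x mod 8 = 6 \<or> x mod 8 = 7" by presburger
  moreover have "x^2 mod 8 = (x mod 8)^2 mod 8" by (simp add: power_mod)
  moreover have "odd x \<longleftrightarrow> odd (x mod 8)" "4 dvd x \<longleftrightarrow> 4 dvd x mod 8" by presburger+
  ultimately show ?thesis by auto
qed

text \<open>Modulo 8 an odd square is 1 and an even one is 0 or 4, so the number of odd coordinates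
  is a multiple of 4; four of them would give the sum 4.\<close>

lemma four_squares_even:
  fixes a b c d :: int
  assumes "8 dvd a^2 + b^2 + c^2 + d^2"
  shows "even a \<and> even b \<and> even c \<and> even d"
proof -
  have "8 dvd (a^2 + b^2 + c^2 + d^2) - ((a^2 - a^2 mod 8) + (b^2 - b^2 mod 8) +
      (c^2 - c^2 mod 8) + (d^2 - d^2 mod 8))"
    by (rule dvd_diff[OF assms], intro dvd_add dvd_minus_mod)
  then have "8 dvd a^2 mod 8 + b^2 mod 8 + c^2 mod 8 + d^2 mod 8" by (simp add: add.assoc)
  then show ?thesis unfolding square_mod_8
    by (cases "even a"; cases "even b"; cases "even c"; cases "even d"; simp split: if_splits)
qed

text \<open>As 8 divides 4 N, every representation of 4 N is twice a representation of N.\<close>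

lemma unique_four_squares_mult4:
  assumes "unique_four_squares N" "even N"
  shows "unique_four_squares (4 * N)"
  unfolding unique_four_squares_def
proof (intro allI impI, elim conjE)
  fix a b c d a' b' c' d' :: int
  assume *: "a \<ge> b" "b \<ge> c" "c \<ge> d" "d \<ge> 0" "a^2 + b^2 + c^2 + d^2 = 4 * N"
     "a' \<ge> b'" "b' \<ge> c'" "c' \<ge> d'" "d' \<ge> 0" "a'^2 + b'^2 + c'^2 + d'^2 = 4 * N"
  have "8 dvd 4 * N" using assms(2) by auto
  then have "even a \<and> even b \<and> even c \<and> even d" "even a' \<and> even b' \<and> even c' \<and> even d'"
    using four_squares_even[of a b c d] four_squares_even[of a' b' c' d'] * by simp_all
  then obtain p q r s p' q' r' s' where
    e: "a = 2 * p" "b = 2 * q" "c = 2 * r" "d = 2 * s" "a' = 2 * p'" "b' = 2 * q'" "c' = 2 * r'" "d' = 2 * s'"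
    by (auto elim!: evenE)
  have "p = p' \<and> q = q' \<and> r = r' \<and> s = s'"
    using assms(1)[unfolded unique_four_squares_def, rule_format, of q p r s q' p' r' s'] *
    unfolding e by (simp add: power_mult_distrib)
  then show "a = a' \<and> b = b' \<and> c = c' \<and> d = d'" by (simp add: e)
qed

lemma unique_four_squares_power4:
  assumes "unique_four_squares N" "even N"
  shows "unique_four_squares (4 ^ r * N)"
proof (induction r)
  case (Suc r)
  then show ?case using unique_four_squares_mult4[of "4 ^ r * N"] assms(2) by (simp add: mult.assoc)
qed (use assms in simp)

text \<open>Taking absolute values and sorting carries both quadruples to the same one, and
  \<open>linear_value\<close> is invariant under signs and permutations.\<close>

lemma linear_value_transfer:
  assumes N: "unique_four_squares N" and "a^2 + b^2 + c^2 + d^2 = N" "a'^2 + b'^2 + c'^2 + d'^2 = N"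
    and "linear_value m s a' b' c' d'"
  shows "linear_value m s a b c d"
proof -
  define nn :: "int \<Rightarrow> int \<Rightarrow> int \<Rightarrow> int \<Rightarrow> bool"
    where "nn a b c d \<longleftrightarrow> a \<ge> 0 \<and> b \<ge> 0 \<and> c \<ge> 0 \<and> d \<ge> 0 \<and> a^2 + b^2 + c^2 + d^2 = N" for a b c d
  have nn_swap: "nn a b c d \<Longrightarrow> nn b a c d" "nn a b c d \<Longrightarrow> nn a c b d" "nn a b c d \<Longrightarrow> nn a b d c"
    for a b c d by (auto simp: nn_def)
  have sorted: "linear_value m s a b c d"
    if "nn a b c d" "a \<ge> b" "b \<ge> c" "c \<ge> d" "nn a' b' c' d'" "linear_value m s a' b' c' d'"
    for a b c d a' b' c' d'
  proof -
    have "nn a' b' c' d' \<longrightarrow> linear_value m s a' b' c' d' \<longrightarrow> linear_value m s a b c d"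
    proof (rule symmetric4_wlog_sorted[of _ a' b' c' d'])
      fix p q r t :: int
      assume "p \<ge> q" "q \<ge> r" "r \<ge> t"
      with that N show "nn p q r t \<longrightarrow> linear_value m s p q r t \<longrightarrow> linear_value m s a b c d"
        unfolding unique_four_squares_def nn_def by metis
    qed (use nn_swap(1) linear_value_swap(1) in blast, use nn_swap(2) linear_value_swap(2) in blast,
        use nn_swap(3) linear_value_swap(3) in blast)
    then show ?thesis using that(5,6) by simp
  qed
  have "nn a b c d \<longrightarrow> nn a' b' c' d' \<longrightarrow> linear_value m s a' b' c' d' \<longrightarrow> linear_value m s a b c d"
    for a b c d a' b' c' d'
    by (rule symmetric4_wlog_sorted[of _ a b c d])
      (use nn_swap(1) linear_value_swap(1) in blast, use nn_swap(2) linear_value_swap(2) in blast,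
        use nn_swap(3) linear_value_swap(3) in blast, use sorted in blast)
  moreover have "nn \<bar>a\<bar> \<bar>b\<bar> \<bar>c\<bar> \<bar>d\<bar>" "nn \<bar>a'\<bar> \<bar>b'\<bar> \<bar>c'\<bar> \<bar>d'\<bar>" using assms by (auto simp: nn_def)
  moreover have "linear_value m s \<bar>a'\<bar> \<bar>b'\<bar> \<bar>c'\<bar> \<bar>d'\<bar>"
    using assms(4) by (rule linear_value_neg) auto
  ultimately have "linear_value m s \<bar>a\<bar> \<bar>b\<bar> \<bar>c\<bar> \<bar>d\<bar>" by blast
  then show ?thesis by (rule linear_value_neg) auto
qed

lemma linear_value_of_three_squares:
  assumes "unique_four_squares N" "splits_off N" "N > 0"
    and "N = a^2 + b^2 + c^2 + d^2" "N * m - s^2 = x^2 + y^2 + z^2"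
  shows "linear_value m s a b c d"
proof -
  have norm: "qnorm (Lip s x y z) = N * m" using assms(5) by simp
  then obtain \<pi> \<gamma> where 1: "qnorm \<pi> = N" "Lip s x y z = \<pi> \<star> \<gamma>"
    using assms(2) unfolding splits_off_def by (metis dvd_triv_left)
  then have "N * qnorm \<gamma> = N * m" using norm by (simp add: qnorm_mul)
  then have 2: "qnorm \<gamma> = m" using assms(3) by simp
  obtain a' b' c' d' x' y' z' t' where e: "\<pi> = Lip a' b' c' d'" "\<gamma> = Lip x' y' z' t'"
    by (metis lipschitz.exhaust)
  \<comment> \<open>The real part of the product is a' x' - b' y' - c' z' - d' t', hence the three
    negated witnesses.\<close>
  have "linear_value m s a' b' c' d'"
    unfolding linear_value_def using 1 2 e
    by (intro exI[of _ x'] exI[of _ "-y'"] exI[of _ "-z'"] exI[of _ "-t'"]) auto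
  then show ?thesis
    using linear_value_transfer[OF assms(1), of a b c d a' b' c' d'] 1 e assms(4) by simp
qed

lemma splits_off_primes: "splits_off 3" "splits_off 5" "splits_off 7" "splits_off 11" "splits_off 23"
proof -
  have "prime (3::int)" "prime (5::int)" "prime (7::int)" "prime (11::int)" "prime (23::int)"
    by (simp_all add: prime_int_numeral_eq)
  then show "splits_off 3" "splits_off 5" "splits_off 7" "splits_off 11" "splits_off 23"
    using splits_off_odd_prime[of 3 "Lip 1 1 1 0"] splits_off_odd_prime[of 5 "Lip 2 1 0 0"]
      splits_off_odd_prime[of 7 "Lip 2 1 1 1"] splits_off_odd_prime[of 11 "Lip 3 1 1 0"]
      splits_off_odd_prime[of 23 "Lip 3 3 2 1"] by simp_all
qed

lemma admissible_norm:
  assumes "N \<in> {1, 3, 5, 7, 11, 15, 23} \<or>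
      (\<exists>g :: nat. odd g \<and> (N = 2 ^ g \<or> N = 3 * 2 ^ g \<or> N = 7 * 2 ^ g))"
  shows "N > 0" "unique_four_squares N" "splits_off N"
proof -
  \<comment> \<open>For odd exponents the three families are 4^r times 2, 6 and 14, which are even
    as the passage from N to 4 N demands.\<close>
  have pow: "(2::int) ^ g = 4 ^ (g div 2) * 2" if "odd g" for g :: nat
    using that by (elim oddE) (simp add: power_mult)
  have 15: "splits_off 15" using splits_off_mult[of 3 5] splits_off_primes by simp
  show "N > 0" using assms by auto
  show "unique_four_squares N"
    using assms unique_four_squares_small unique_four_squares_power4[of 2]
      unique_four_squares_power4[of 6] unique_four_squares_power4[of 14]
    by (auto simp: pow mult.commute mult.left_commute)
  show "splits_off N"
    using assms splits_off_1 splits_off_primes 15 splits_off_power2 splits_off_mult[OF splits_off_primes(1)]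
      splits_off_mult[OF splits_off_primes(3)] by auto
qed

section \<open>Real characters and the hyperbola method\<close>

text \<open>A Dirichlet character with integer values, the principal one included. Being
  non-principal is expressed by exhibiting an argument with value -1.\<close>

definition real_character :: "nat \<Rightarrow> (nat \<Rightarrow> int) \<Rightarrow> bool" where
  "real_character M f \<longleftrightarrow> M > 0 \<and> (\<forall>a b. f (a * b) = f a * f b) \<and> (\<forall>a. f (a + M) = f a) \<and>
     (\<forall>a. coprime a M \<longrightarrow> f a = 1 \<or> f a = -1) \<and> (\<forall>a. \<not> coprime a M \<longrightarrow> f a = 0)"

lemma real_characterD:
  assumes "real_character M f"
  shows "M > 0" "f (a * b) = f a * f b" "f (a + M) = f a"
    "coprime a M \<Longrightarrow> f a = 1 \<or> f a = -1" "\<not> coprime a M \<Longrightarrow> f a = 0"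
  using assms unfolding real_character_def by blast+

lemma real_character_cases:
  assumes "real_character M f"
  shows "f a = 0 \<or> f a = 1 \<or> f a = -1"
  using real_characterD(4,5)[OF assms] by blast

lemma real_character_1: "real_character M f \<Longrightarrow> f 1 = 1"
proof -
  assume f: "real_character M f"
  have "f (1 * 1) = f 1 * f 1" "f 1 = 1 \<or> f 1 = -1"
    using real_characterD(2)[OF f, of 1 1] real_characterD(4)[OF f, of 1] by simp_all
  then show "f 1 = 1" by auto
qed

lemma real_character_mod:
  assumes "real_character M f"
  shows "f (a mod M) = f a"
proof -
  have "f (a mod M + k * M) = f (a mod M)" for k
  proof (induction k)
    case (Suc k)
    have "f (a mod M + k * M + M) = f (a mod M + k * M)"
      using assms unfolding real_character_def by blast
    with Suc show ?case by (simp add: ac_simps)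
  qed simp
  from this[of "a div M"] show ?thesis by simp
qed

lemma real_character_mult:
  assumes "real_character M f" "real_character M g"
  shows "real_character M (\<lambda>a. f a * g a)"
  unfolding real_character_def
proof (intro conjI allI impI)
  fix a b
  show "M > 0" "f (a + M) * g (a + M) = f a * g a"
    using real_characterD(1,3)[OF assms(1)] real_characterD(3)[OF assms(2)] by simp_all
  show "f (a * b) * g (a * b) = f a * g a * (f b * g b)"
    by (simp add: real_characterD(2)[OF assms(1)] real_characterD(2)[OF assms(2)])
  show "f a * g a = 1 \<or> f a * g a = -1" if "coprime a M"
    using real_characterD(4)[OF assms(1) that] real_characterD(4)[OF assms(2) that] by auto
  show "f a * g a = 0" if "\<not> coprime a M"
    using real_characterD(5)[OF assms(1) that] by simp
qed

lemma real_character_principal: "M > 0 \<Longrightarrow> real_character M (\<lambda>a. of_bool (coprime a M))"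
  unfolding real_character_def
proof (intro conjI allI impI)
  fix a b
  have "coprime (a + M) M \<longleftrightarrow> coprime a M" by (simp only: coprime_iff_gcd_eq_1 gcd_add1)
  then show "of_bool (coprime (a + M) M) = (of_bool (coprime a M) :: int)" by simp
qed auto

lemma real_character_prod:
  assumes "M > 0" "finite J" "\<And>i. i \<in> J \<Longrightarrow> real_character M (\<psi> i)"
  shows "real_character M (\<lambda>a. of_bool (coprime a M) * (\<Prod>i\<in>J. \<psi> i a))"
  using assms(2,3)
proof (induction J rule: finite_induct)
  case empty
  then show ?case using real_character_principal[OF assms(1)] by simp
next
  case (insert i J)
  have "real_character M (\<lambda>a. \<psi> i a * (of_bool (coprime a M) * (\<Prod>i\<in>J. \<psi> i a)))"
    using insert by (intro real_character_mult[of M "\<psi> i"]) auto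
  then show ?case using insert.hyps by (simp add: mult.left_commute)
qed

text \<open>Multiplication by v permutes the residues modulo M and negates the sum.\<close>

lemma real_character_sum_period:
  assumes "real_character M f" "f v = -1"
  shows "(\<Sum>k<M. f k) = 0"
proof -
  have M: "M > 0" and cop: "coprime v M"
    using real_characterD(1,5)[OF assms(1)] assms(2) by (auto, fastforce)
  have "inj_on (\<lambda>k. v * k mod M) {..<M}"
  proof (rule inj_onI)
    fix j k assume jk: "j \<in> {..<M}" "k \<in> {..<M}" "v * j mod M = v * k mod M"
    then have "[v * j = v * k] (mod M)" by (simp add: cong_def)
    then have "[j = k] (mod M)" using cop by (simp add: cong_mult_lcancel_nat)
    with jk show "j = k" by (simp add: cong_def)
  qed
  then have "bij_betw (\<lambda>k. v * k mod M) {..<M} {..<M}"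
    using M by (intro bij_betw_imageI endo_inj_surj) auto
  then have "(\<Sum>k<M. f k) = (\<Sum>k<M. f (v * k mod M))"
    by (rule sum.reindex_bij_betw[symmetric])
  also have "\<dots> = (\<Sum>k<M. f v * f k)"
    by (simp add: real_character_mod[OF assms(1)] real_characterD(2)[OF assms(1)])
  also have "\<dots> = - (\<Sum>k<M. f k)" by (simp add: assms(2) sum_negf)
  finally show ?thesis by simp
qed

lemma real_character_partial_sums:
  assumes "real_character M f" "f v = -1"
  shows "\<bar>\<Sum>k<n. real_of_int (f k)\<bar> \<le> real M"
proof (induction n rule: less_induct)
  case (less n)
  show ?case
  proof (cases "n < M")
    case True
    have "\<bar>\<Sum>k<n. real_of_int (f k)\<bar> \<le> (\<Sum>k<n. 1)"
    proof (rule order.trans[OF sum_abs], rule sum_mono)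
      show "\<bar>real_of_int (f k)\<bar> \<le> 1" for k
        using real_character_cases[OF assms(1), of k] by auto
    qed
    also have "\<dots> \<le> real M" using True by simp
    finally show ?thesis .
  next
    case False
    have M: "M > 0" using real_characterD(1)[OF assms(1)] .
    obtain m where n: "n = M + m" using False by (metis le_Suc_ex not_less)
    have "(\<Sum>k<M + m. real_of_int (f k)) = (\<Sum>k<M. real_of_int (f k)) + (\<Sum>k<m. real_of_int (f (k + M)))"
      by (induction m) (simp_all add: add.commute)
    also have "\<dots> = (\<Sum>k<m. real_of_int (f k))"
      using real_character_sum_period[OF assms]
      by (simp add: real_characterD(3)[OF assms(1)] flip: of_int_sum)
    finally show ?thesis using less[of m] M n by simp
  qed
qed

text \<open>Summation by parts: the boundary terms contribute at most B (w n + w m), the telescoping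
  differences at most B (w m - w n).\<close>

lemma abel_bound:
  fixes f w :: "nat \<Rightarrow> real"
  assumes B: "\<And>n. \<bar>\<Sum>k<n. f k\<bar> \<le> B"
    and w: "\<And>k. k \<ge> m \<Longrightarrow> w (Suc k) \<le> w k" "\<And>k. k \<ge> m \<Longrightarrow> 0 \<le> w k" and "m \<le> n"
  shows "\<bar>\<Sum>k=m..<n. f k * w k\<bar> \<le> 2 * B * w m"
proof -
  define F where "F n = (\<Sum>k<n. f k)" for n
  have id: "(\<Sum>k=m..<n. f k * w k) = F n * w n - F m * w m + (\<Sum>k=m..<n. F (Suc k) * (w k - w (Suc k)))"
    using \<open>m \<le> n\<close> by (induction n rule: dec_induct) (simp_all add: F_def algebra_simps)
  have tel: "(\<Sum>k=m..<n. B * (w k - w (Suc k))) = B * (w m - w n)"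
    using \<open>m \<le> n\<close> by (induction n rule: dec_induct) (simp_all add: algebra_simps)
  have "\<bar>\<Sum>k=m..<n. F (Suc k) * (w k - w (Suc k))\<bar> \<le> (\<Sum>k=m..<n. B * (w k - w (Suc k)))"
  proof (rule order.trans[OF sum_abs], rule sum_mono)
    fix k assume "k \<in> {m..<n}"
    then show "\<bar>F (Suc k) * (w k - w (Suc k))\<bar> \<le> B * (w k - w (Suc k))"
      using w(1)[of k] B[of "Suc k"] unfolding abs_mult by (intro mult_mono) (auto simp: F_def)
  qed
  moreover have "\<bar>F n * w n\<bar> \<le> B * w n" "\<bar>F m * w m\<bar> \<le> B * w m"
    unfolding abs_mult using B w(2) \<open>m \<le> n\<close> by (auto simp: F_def intro!: mult_right_mono)
  ultimately show ?thesis unfolding id using tel by (simp add: algebra_simps)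
qed

section \<open>Sums over the region under a hyperbola\<close>

lemma sum_inverse_sqrt_le: "(\<Sum>k=1..n. 1 / sqrt (real k)) \<le> 2 * sqrt (real n)"
proof (induction n)
  case (Suc n)
  have "1 \<le> 2 * sqrt (Suc n) * (sqrt (Suc n) - sqrt n)"
  proof -
    have "2 * (sqrt (Suc n) * sqrt n) \<le> (sqrt (Suc n))^2 + (sqrt n)^2"
      using sum_squares_bound[of "sqrt (Suc n)" "sqrt n"] by simp
    then show ?thesis by (simp add: algebra_simps)
  qed
  then have "1 / sqrt (Suc n) \<le> 2 * (sqrt (Suc n) - sqrt n)"
    by (simp add: field_simps)
  with Suc show ?case by simp
qed simp

text \<open>The bound is a square, so that the region is cut at the integer
  \<open>y\<close>.\<close>

definition hyperbola :: "nat \<Rightarrow> (nat \<times> nat) set" where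
  "hyperbola y = {(a, b). 1 \<le> a \<and> 1 \<le> b \<and> a * b \<le> y^2}"

lemma finite_hyperbola [simp]: "finite (hyperbola y)"
proof (rule finite_subset)
  show "hyperbola y \<subseteq> {1..y^2} \<times> {1..y^2}"
  proof
    fix x assume "x \<in> hyperbola y"
    then obtain a b where x: "x = (a, b)" "1 \<le> a" "1 \<le> b" "a * b \<le> y^2" by (auto simp: hyperbola_def)
    then have "a * 1 \<le> a * b" "1 * b \<le> a * b" by (intro mult_le_mono; simp)+
    with x show "x \<in> {1..y^2} \<times> {1..y^2}" using order.trans[OF _ x(4)] by simp
  qed
qed simp

text \<open>The region is the square a, b \<le> y together with two mirror strips. The square gives
  a product of two sums bounded by 2 B. In a strip the inner sum is at most 2 B / sqrt (y + 1) by
  summation by parts and the outer weights add up to at most 2 sqrt y, so each strip contributes at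
  most 4 B.\<close>

lemma hyperbola_bound:
  fixes f g :: "nat \<Rightarrow> real"
  assumes "\<And>n. \<bar>\<Sum>k<n. f k\<bar> \<le> B" "\<And>n. \<bar>\<Sum>k<n. g k\<bar> \<le> B"
    and "\<And>k. \<bar>f k\<bar> \<le> 1" "\<And>k. \<bar>g k\<bar> \<le> 1"
  shows "\<bar>\<Sum>(a, b)\<in>hyperbola y. f a * g b / sqrt (a * b)\<bar> \<le> 4 * B^2 + 8 * B"
proof -
  have B0: "B \<ge> 0" using assms(1)[of 0] by simp
  define w where "w k = 1 / sqrt (real k)" for k :: nat
  have w: "w (Suc k) \<le> w k" if "k \<ge> 1" for k
    unfolding w_def using that by (intro divide_left_mono) auto
  have tail: "\<bar>\<Sum>k\<in>{m<..n}. h k * w k\<bar> \<le> 2 * B * w (Suc m)"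
    if "\<And>n. \<bar>\<Sum>k<n. h k\<bar> \<le> B" for h m n
  proof (cases "m \<le> n")
    case True
    have "{m<..n} = {Suc m..<Suc n}" by auto
    then show ?thesis using abel_bound[OF that, of "Suc m" w "Suc n"] w True by (simp add: w_def)
  next
    case False
    then show ?thesis using B0 by (simp add: w_def)
  qed
  have full: "\<bar>\<Sum>k=1..n. h k * w k\<bar> \<le> 2 * B" if "\<And>n. \<bar>\<Sum>k<n. h k\<bar> \<le> B" for h n
    using tail[OF that, of 0 n] by (simp add: w_def atLeastSucAtMost_greaterThanAtMost)
  define S where "S = (SIGMA a:{1..y}. {y<..y^2 div a})"
  have side: "\<bar>\<Sum>(a, b)\<in>S. (h a * w a) * (k b * w b)\<bar> \<le> 4 * B"
    if h: "\<And>k. \<bar>h k\<bar> \<le> 1" and k: "\<And>n. \<bar>\<Sum>j<n. k j\<bar> \<le> B" for h k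
  proof -
    have "\<bar>\<Sum>(a, b)\<in>S. (h a * w a) * (k b * w b)\<bar> =
        \<bar>\<Sum>a=1..y. (h a * w a) * (\<Sum>b\<in>{y<..y^2 div a}. k b * w b)\<bar>"
      unfolding S_def by (subst sum.Sigma[symmetric]) (auto simp: sum_distrib_left)
    also have "\<dots> \<le> (\<Sum>a=1..y. w a * (2 * B * w (Suc y)))"
    proof (rule order.trans[OF sum_abs], rule sum_mono)
      fix a
      have "\<bar>h a * w a\<bar> \<le> w a" using h[of a] by (simp add: abs_mult w_def divide_le_eq divide_right_mono)
      then show "\<bar>(h a * w a) * (\<Sum>b\<in>{y<..y^2 div a}. k b * w b)\<bar> \<le> w a * (2 * B * w (Suc y))"
        unfolding abs_mult[of "h a * w a"] using tail[OF k] by (intro mult_mono) (auto simp: w_def)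
    qed
    also have "\<dots> = (\<Sum>a=1..y. 1 / sqrt a) * (2 * B * w (Suc y))"
      by (simp only: w_def sum_distrib_right)
    also have "\<dots> \<le> (2 * sqrt y) * (2 * B * w (Suc y))"
      using B0 by (intro mult_right_mono sum_inverse_sqrt_le) (auto simp: w_def)
    also have "\<dots> = 4 * B * (sqrt y / sqrt (Suc y))" by (simp add: w_def)
    also have "\<dots> \<le> 4 * B * 1" using B0 by (intro mult_left_mono) auto
    finally show ?thesis by simp
  qed
  define R where "R = {1..y} \<times> {1..y}"
  have split: "hyperbola y = R \<union> (S \<union> prod.swap ` S)"
  proof (rule Set.set_eqI)
    fix x :: "nat \<times> nat"
    obtain a b where x: "x = (a, b)" by (cases x)
    have S: "(a, b) \<in> S \<longleftrightarrow> 1 \<le> a \<and> a \<le> y \<and> y < b \<and> a * b \<le> y^2" for a b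
    proof (cases "a = 0")
      case False
      then show ?thesis by (simp add: S_def less_eq_div_iff_mult_less_eq mult.commute[of b])
    qed (simp add: S_def)
    have sw: "(a, b) \<in> prod.swap ` S \<longleftrightarrow> (b, a) \<in> S" by (rule pair_in_swap_image)
    have R: "a * b \<le> y^2" if "a \<le> y" "b \<le> y" using that by (simp add: power2_eq_square mult_le_mono)
    have "\<not> a * b \<le> y^2" if "y < a" "y < b"
      using mult_strict_mono[of y a y b] that by (simp add: power2_eq_square)
    then show "x \<in> hyperbola y \<longleftrightarrow> x \<in> R \<union> (S \<union> prod.swap ` S)"
      unfolding x using R by (auto simp: hyperbola_def R_def S sw mult.commute)
  qed
  have fin: "finite R" "finite S" by (auto simp: R_def S_def)
  have disj: "R \<inter> (S \<union> prod.swap ` S) = {}" "S \<inter> prod.swap ` S = {}"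
    by (auto simp: R_def S_def)
  define t where "t = (\<lambda>(a, b). (f a * w a) * (g b * w b))"
  have "(\<Sum>(a, b)\<in>hyperbola y. f a * g b / sqrt (a * b)) = sum t (hyperbola y)"
    by (intro sum.cong) (auto simp: t_def w_def real_sqrt_mult)
  also have "\<dots> = sum t R + (sum t S + sum t (prod.swap ` S))"
    unfolding split using fin disj by (simp add: sum.union_disjoint)
  also have "sum t (prod.swap ` S) = (\<Sum>(a, b)\<in>S. (g a * w a) * (f b * w b))"
    by (subst sum.reindex) (auto simp: t_def case_prod_unfold mult.commute)
  also have "sum t R = (\<Sum>a=1..y. f a * w a) * (\<Sum>b=1..y. g b * w b)"
    by (simp add: t_def R_def sum_product sum.cartesian_product)
  finally have eq: "(\<Sum>(a, b)\<in>hyperbola y. f a * g b / sqrt (a * b)) =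
      (\<Sum>a=1..y. f a * w a) * (\<Sum>b=1..y. g b * w b) +
      (sum t S + (\<Sum>(a, b)\<in>S. (g a * w a) * (f b * w b)))" .
  have "\<bar>(\<Sum>a=1..y. f a * w a) * (\<Sum>b=1..y. g b * w b)\<bar> \<le> (2 * B) * (2 * B)"
    unfolding abs_mult using full[OF assms(1)] full[OF assms(2)] B0 by (intro mult_mono) auto
  moreover have "\<bar>sum t S\<bar> \<le> 4 * B" unfolding t_def by (rule side) fact+
  moreover have "\<bar>\<Sum>(a, b)\<in>S. (g a * w a) * (f b * w b)\<bar> \<le> 4 * B" by (rule side) fact+
  ultimately show ?thesis unfolding eq by (simp add: power2_eq_square)
qed

section \<open>Integers with prescribed character values\<close>

definition divisor_sum :: "(nat \<Rightarrow> int) \<Rightarrow> nat \<Rightarrow> int" where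
  "divisor_sum f v = (\<Sum>d | d dvd v. f d)"

text \<open>Each divisor is q^i d with i \<le> k and d dividing m in exactly one way.\<close>

lemma divisor_sum_prime_power_mult:
  assumes f: "real_character M f" and q: "prime q" "\<not> q dvd m" and m: "m > 0"
  shows "divisor_sum f (q ^ k * m) = (\<Sum>i\<le>k. f q ^ i) * divisor_sum f m"
proof -
  have pow: "f (q ^ i) = f q ^ i" for i
    by (induction i) (use real_character_1[OF f] real_characterD(2)[OF f] in auto)
  have "bij_betw (\<lambda>(i, d). q ^ i * d) ({..k} \<times> {d. d dvd m}) {d. d dvd q ^ k * m}"
    unfolding bij_betw_def
  proof
    show "inj_on (\<lambda>(i, d). q ^ i * d) ({..k} \<times> {d. d dvd m})"
    proof (rule inj_onI, clarify)
      fix i j d e assume de: "d dvd m" "e dvd m" and eq: "q ^ i * d = q ^ j * e"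
      have nd: "\<not> q dvd d" "\<not> q dvd e" using de q dvd_trans by blast+
      have "d > 0" "e > 0" using de m by (auto intro: dvd_pos_nat)
      have "multiplicity q (q ^ i * d) = i" "multiplicity q (q ^ j * e) = j"
        using nd \<open>d > 0\<close> \<open>e > 0\<close> q(1)
        by (simp_all add: prime_elem_multiplicity_mult_distrib not_dvd_imp_multiplicity_0)
      with eq have "i = j" by simp
      with eq q(1) show "i = j \<and> d = e" by (auto simp: prime_gt_0_nat)
    qed
    show "(\<lambda>(i, d). q ^ i * d) ` ({..k} \<times> {d. d dvd m}) = {d. d dvd q ^ k * m}"
    proof (intro equalityI subsetI)
      fix x assume "x \<in> {d. d dvd q ^ k * m}"
      then obtain b c where bc: "x = b * c" "b dvd q ^ k" "c dvd m"
        using division_decomp by blast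
      then obtain i where "i \<le> k" "b = q ^ i" using q(1) divides_primepow_nat by blast
      with bc show "x \<in> (\<lambda>(i, d). q ^ i * d) ` ({..k} \<times> {d. d dvd m})" by auto
    qed (auto intro: mult_dvd_mono le_imp_power_dvd)
  qed
  then have "divisor_sum f (q ^ k * m) = (\<Sum>(i, d)\<in>{..k} \<times> {d. d dvd m}. f (q ^ i * d))"
    unfolding divisor_sum_def by (subst sum.reindex_bij_betw[symmetric]) (auto simp: case_prod_unfold)
  also have "\<dots> = (\<Sum>i\<le>k. f q ^ i) * divisor_sum f m"
    by (simp add: divisor_sum_def sum_product sum.cartesian_product real_characterD(2)[OF f] pow)
  finally show ?thesis .
qed

lemma sign_power_sum:
  assumes "x = 0 \<or> x = 1 \<or> x = (-1::int)"
  shows "(\<Sum>i\<le>k. x ^ i) \<ge> 0" "even k \<Longrightarrow> (\<Sum>i\<le>k. x ^ i) \<ge> 1"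
    "x = -1 \<Longrightarrow> odd k \<Longrightarrow> (\<Sum>i\<le>k. x ^ i) = 0"
proof -
  have "(\<Sum>i\<le>k. (-1) ^ i) = (if even k then 1 else (0::int))" by (induction k) auto
  moreover have "(\<Sum>i\<le>k. 0 ^ i) = (1::int)" by (induction k) auto
  ultimately show "(\<Sum>i\<le>k. x ^ i) \<ge> 0" "even k \<Longrightarrow> (\<Sum>i\<le>k. x ^ i) \<ge> 1"
    "x = -1 \<Longrightarrow> odd k \<Longrightarrow> (\<Sum>i\<le>k. x ^ i) = 0"
    using assms by auto
qed

text \<open>Serves inductions that peel off the full power of one prime, as
  \<open>divisor_sum_prime_power_mult\<close> requires.\<close>

lemma strip_prime:
  assumes "(v::nat) > 1"
  obtains q k m where "prime q" "v = q ^ k * m" "\<not> q dvd m" "0 < m" "m < v"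
proof -
  obtain q where q: "prime q" "q dvd v" using assms prime_factor_nat by (metis less_irrefl)
  obtain m where m: "v = q ^ multiplicity q v * m" "\<not> q dvd m"
    using multiplicity_decompose'[of v q] assms q(1) by (metis not_prime_unit less_numeral_extra(3) not_less_zero)
  have k: "multiplicity q v > 0" using q assms by (simp add: prime_multiplicity_gt_zero_iff)
  have "m > 0" using m assms by (cases m) auto
  moreover have "q ^ multiplicity q v > 1" using one_less_power[OF prime_gt_1_nat[OF q(1)] k] .
  then have "m < v" using \<open>m > 0\<close> by (subst m(1)) simp
  ultimately show ?thesis using that q m by blast
qed

lemma divisor_sum_1: "real_character M f \<Longrightarrow> divisor_sum f (Suc 0) = 1"
  using real_character_1 by (simp add: divisor_sum_def)

lemma divisor_sum_nonneg:
  assumes f: "real_character M f" and "v > 0"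
  shows "divisor_sum f v \<ge> 0"
  using assms(2)
proof (induction v rule: less_induct)
  case (less v)
  show ?case
  proof (cases "v = 1")
    case False
    with less.prems obtain q k m where "prime q" "v = q ^ k * m" "\<not> q dvd m" "0 < m" "m < v"
      using strip_prime[of v] by auto
    then show ?thesis
      using less.IH[of m] sign_power_sum(1)[OF real_character_cases[OF f]]
      by (simp add: divisor_sum_prime_power_mult[OF f])
  qed (simp add: divisor_sum_1[OF f])
qed

text \<open>All exponents in a square are even, and 1 + x + ... + x^(2 k) is at least 1 for x in {0,
  1, -1}.\<close>

lemma divisor_sum_square:
  assumes f: "real_character M f" and "w > 0"
  shows "divisor_sum f (w^2) \<ge> 1"
  using assms(2)
proof (induction w rule: less_induct)
  case (less w)
  show ?case
  proof (cases "w = 1")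
    case False
    with less.prems obtain q k m where *: "prime q" "w = q ^ k * m" "\<not> q dvd m" "0 < m" "m < w"
      using strip_prime[of w] by auto
    have "w^2 = q ^ (2 * k) * m^2" using * by (simp add: power_mult_distrib power_mult mult.commute)
    moreover have "\<not> q dvd m^2" using * prime_dvd_power by blast
    moreover have "(\<Sum>i\<le>2 * k. f q ^ i) \<ge> 1" "divisor_sum f (m^2) \<ge> 1"
      using less.IH[of m] * sign_power_sum(2)[OF real_character_cases[OF f], of "2 * k"] by auto
    then have "(\<Sum>i\<le>2 * k. f q ^ i) * divisor_sum f (m^2) \<ge> 1 * 1"
      by (intro mult_mono; linarith)
    ultimately show ?thesis
      using * by (simp add: divisor_sum_prime_power_mult[OF f])
  qed (simp add: divisor_sum_1[OF f])
qed

text \<open>If f q = -1 and the exponent of q is odd, the factor belonging to q is 1 - 1 + ... - 1 =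
  0.\<close>

lemma divisor_sum_nonzero_imp_split:
  assumes f: "real_character M f" and "v > 0" "divisor_sum f v \<noteq> 0" "prime q" "odd (multiplicity q v)"
  shows "f q \<noteq> -1"
proof
  assume "f q = -1"
  obtain m where m: "v = q ^ multiplicity q v * m" "\<not> q dvd m"
    using multiplicity_decompose'[of v q] assms(2,4) by (metis not_prime_unit not_less_zero)
  then have "m > 0" using assms(2) by (cases m) auto
  then have "divisor_sum f v = 0"
    using divisor_sum_prime_power_mult[OF f assms(4) m(2), of "multiplicity q v"] m(1)
      sign_power_sum(3)[of "f q" "multiplicity q v"] assms(5) \<open>f q = -1\<close> by simp
  with assms(3) show False ..
qed

text \<open>The pairs are grouped by their product v = a b.\<close>

lemma sum_hyperbola_eq:
  fixes h g :: "nat \<Rightarrow> real"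
  shows "(\<Sum>(a, b)\<in>hyperbola y. h (a * b) * g b) = (\<Sum>v=1..y^2. h v * (\<Sum>d | d dvd v. g d))"
proof -
  have "(\<Sum>v=1..y^2. h v * (\<Sum>d | d dvd v. g d)) =
      (\<Sum>(v, d)\<in>(SIGMA v:{1..y^2}. {d. d dvd v}). h v * g d)"
    by (subst sum.Sigma[symmetric]) (auto simp: sum_distrib_left)
  also have "\<dots> = (\<Sum>(a, b)\<in>hyperbola y. h (a * b) * g b)"
    by (rule sum.reindex_bij_witness[of _ "\<lambda>(a, b). (a * b, b)" "\<lambda>(v, d). (v div d, d)"])
       (auto simp: hyperbola_def dvd_div_eq_0_iff Suc_le_eq intro: Nat.gr0I dest: dvd_imp_le elim: dvdE)
  finally show ?thesis ..
qed

lemma prod_one_plus: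
  fixes u :: "'i \<Rightarrow> 'a :: comm_ring_1"
  assumes "finite P"
  shows "(\<Prod>i\<in>P. 1 + u i) = (\<Sum>J\<in>Pow P. \<Prod>i\<in>J. u i)"
  using prod_add[OF assms, of u "\<lambda>_. 1"] by (simp add: add.commute)

text \<open>The squares alone make this sum diverge, so nothing about the value of the L-series
  of \<open>f\<close> at 1 is needed.\<close>

lemma divisor_sum_diverges:
  assumes f: "real_character M f"
  shows "\<exists>y. (\<Sum>v=1..y^2. of_bool (coprime v M) / sqrt (real v) * real_of_int (divisor_sum f v)) > K"
proof -
  have M: "M > 0" using real_characterD(1)[OF f] .
  have "\<forall>\<^sub>F J in sequentially. harm J > K * real M"
    using harm_at_top by (simp add: filterlim_at_top_dense)
  then obtain J where J: "harm J > K * real M" by (meson eventually_sequentially order_refl)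
  define y where "y = 1 + J * M"
  define t where "t v = of_bool (coprime v M) / sqrt (real v) * real_of_int (divisor_sum f v)" for v
  \<comment> \<open>The numbers 1 + j M are coprime to M. The square of each has divisor sum at
    least 1 and so contributes at least 1 / (M (j + 1)), a multiple of the harmonic series.\<close>
  define A where "A = (\<lambda>j. (1 + j * M)^2) ` {..<J}"
  have inj: "inj_on (\<lambda>j. (1 + j * M)^2) {..<J}"
    using M by (intro inj_onI) (simp add: power2_eq_iff_nonneg)
  have tpos: "t v \<ge> 0" if "v > 0" for v
    using divisor_sum_nonneg[OF f that] by (simp add: t_def)
  have "K < (1 / real M) * harm J" using J M by (simp add: field_simps)
  also have "\<dots> = (\<Sum>j<J. 1 / (real M * real (Suc j)))"
    by (simp add: harm_altdef sum_distrib_left field_simps)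
  also have "\<dots> \<le> (\<Sum>j<J. t ((1 + j * M)^2))"
  proof (rule sum_mono)
    fix j
    have "coprime (1 + j * M) M"
    proof (rule coprimeI)
      fix c assume "c dvd 1 + j * M" "c dvd M"
      then show "is_unit c" by (metis dvd_add_left_iff dvd_mult)
    qed
    then have "coprime ((1 + j * M)^2) M" by simp
    then have t: "t ((1 + j * M)^2) = 1 / real (1 + j * M) * real_of_int (divisor_sum f ((1 + j * M)^2))"
      by (simp add: t_def)
    have "1 / (real M * real (Suc j)) \<le> 1 / real (1 + j * M) * 1"
      using M by (simp add: frac_le field_simps flip: of_nat_mult of_nat_add of_nat_Suc)
    also have "\<dots> \<le> t ((1 + j * M)^2)"
      unfolding t using divisor_sum_square[OF f, of "1 + j * M"] by (intro mult_left_mono) auto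
    finally show "1 / (real M * real (Suc j)) \<le> t ((1 + j * M)^2)" .
  qed
  also have "\<dots> = sum t A" unfolding A_def by (subst sum.reindex[OF inj]) simp
  also have "\<dots> \<le> (\<Sum>v=1..y^2. t v)"
  proof (rule sum_mono2)
    show "A \<subseteq> {1..y^2}" unfolding A_def y_def by (auto intro!: power_mono)
  qed (use tpos in auto)
  finally show ?thesis unfolding t_def by blast
qed

text \<open>Summing \<open>(\<Prod>i\<in>P. 1 + \<epsilon> i * \<psi> i v) * divisor_sum \<theta> v / sqrt v\<close> over \<open>v\<close> singles out the
  wanted \<open>v\<close>. In the expansion of the product the term of \<open>J = {}\<close> diverges, a term whose two factors
  \<open>\<psi>\<^sub>J\<close> and \<open>\<psi>\<^sub>J \<theta>\<close> are non-principal stays bounded, and a term with \<open>\<psi>\<^sub>J = \<theta>\<close> repeats the divergent one,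
  so its sign matters.\<close>

lemma character_values_exist:
  fixes \<psi> :: "'i \<Rightarrow> nat \<Rightarrow> int" and \<epsilon> :: "'i \<Rightarrow> int"
  assumes P: "finite P" and \<psi>: "\<And>i. i \<in> P \<Longrightarrow> real_character M (\<psi> i)" and \<theta>: "real_character M \<theta>"
    and \<epsilon>: "\<And>i. i \<in> P \<Longrightarrow> \<epsilon> i = 1 \<or> \<epsilon> i = -1"
    and indep: "\<And>J. J \<subseteq> P \<Longrightarrow> J \<noteq> {} \<Longrightarrow>
      ((\<exists>v. coprime v M \<and> (\<Prod>i\<in>J. \<psi> i v) = -1) \<and> (\<exists>v. coprime v M \<and> (\<Prod>i\<in>J. \<psi> i v) * \<theta> v = -1))
      \<or> ((\<forall>v. coprime v M \<longrightarrow> (\<Prod>i\<in>J. \<psi> i v) = \<theta> v) \<and> (\<Prod>i\<in>J. \<epsilon> i) = 1)"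
  shows "\<exists>v>0. coprime v M \<and> divisor_sum \<theta> v \<noteq> 0 \<and> (\<forall>i\<in>P. \<psi> i v = \<epsilon> i)"
proof (rule ccontr)
  assume contra: "\<not> ?thesis"
  have M: "M > 0" using real_characterD(1)[OF \<theta>] .
  \<comment> \<open>The factor \<open>of_bool (coprime v M)\<close> turns the empty product into the
    principal character modulo M.\<close>
  define \<Psi> where "\<Psi> J v = of_bool (coprime v M) * (\<Prod>i\<in>J. \<psi> i v)" for J v
  define S where "S J y = (\<Sum>(a, b)\<in>hyperbola y. (\<Psi> J (a * b) / sqrt (a * b)) * \<theta> b)" for J y
  have S: "S J y = (\<Sum>v=1..y^2. (\<Psi> J v / sqrt v) * divisor_sum \<theta> v)" for J y
    unfolding S_def divisor_sum_def of_int_sum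
    by (rule sum_hyperbola_eq[of "\<lambda>v. \<Psi> J v / sqrt v" "\<lambda>b. real_of_int (\<theta> b)"])
  have rc: "real_character M (\<Psi> J)" if "J \<subseteq> P" for J
    unfolding \<Psi>_def using that \<psi> P M by (intro real_character_prod) (auto dest: finite_subset)
  have T: "S {} y \<ge> 0" for y
    unfolding S using divisor_sum_nonneg[OF \<theta>] by (intro sum_nonneg) (auto simp: \<Psi>_def)
  define e where "e J = (\<Prod>i\<in>J. \<epsilon> i)" for J
  define C where "C = 4 * real M ^ 2 + 8 * real M"
  have lower: "e J * S J y \<ge> - C" if J: "J \<subseteq> P" "J \<noteq> {}" for J y
    using indep[OF J]
  proof
    assume "(\<exists>v. coprime v M \<and> (\<Prod>i\<in>J. \<psi> i v) = -1) \<and> (\<exists>v. coprime v M \<and> (\<Prod>i\<in>J. \<psi> i v) * \<theta> v = -1)"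
    then obtain v w where "coprime v M" "(\<Prod>i\<in>J. \<psi> i v) = -1" "coprime w M" "(\<Prod>i\<in>J. \<psi> i w) * \<theta> w = -1"
      by blast
    then have v: "\<Psi> J v = -1" and w: "\<Psi> J w * \<theta> w = -1" by (simp_all add: \<Psi>_def)
    \<comment> \<open>\<open>\<Psi> J (a * b) * \<theta> b\<close> factors as
      \<open>\<Psi> J a * g b\<close>, a product of two non-principal characters to which the
      hyperbola bound applies.\<close>
    define g where "g a = \<Psi> J a * \<theta> a" for a
    have g: "real_character M g" unfolding g_def by (intro real_character_mult rc J \<theta>)
    have bounded: "\<bar>real_of_int (h a)\<bar> \<le> 1" if "real_character M h" for h a
      using real_character_cases[OF that, of a] by auto
    have "\<bar>\<Sum>(a, b)\<in>hyperbola y. real_of_int (\<Psi> J a) * real_of_int (g b) / sqrt (a * b)\<bar> \<le> C"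
      unfolding C_def using v w
      by (intro hyperbola_bound real_character_partial_sums[OF rc[OF J(1)]]
          real_character_partial_sums[OF g] bounded rc J g) (auto simp: g_def)
    also have "(\<Sum>(a, b)\<in>hyperbola y. real_of_int (\<Psi> J a) * real_of_int (g b) / sqrt (a * b)) = S J y"
      unfolding S_def g_def
      by (intro sum.cong) (auto simp: real_characterD(2)[OF rc[OF J(1)]])
    finally have "\<bar>S J y\<bar> \<le> C" .
    moreover have "\<bar>\<Prod>i\<in>J. \<epsilon> i\<bar> = 1"
    proof -
      have "\<bar>\<epsilon> i\<bar> = 1" if "i \<in> J" for i
        using \<epsilon>[OF subsetD[OF J(1) that]] by auto
      then have "\<bar>\<Prod>i\<in>J. \<epsilon> i\<bar> = (\<Prod>i\<in>J. 1)"
        unfolding abs_prod by (intro prod.cong) auto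
      then show ?thesis by simp
    qed
    then have "\<bar>e J * S J y\<bar> = \<bar>S J y\<bar>"
      by (simp add: abs_mult e_def flip: of_int_abs del: of_int_prod)
    ultimately show ?thesis by linarith
  next
    assume *: "(\<forall>v. coprime v M \<longrightarrow> (\<Prod>i\<in>J. \<psi> i v) = \<theta> v) \<and> (\<Prod>i\<in>J. \<epsilon> i) = 1"
    \<comment> \<open>Where a b is coprime to M, \<open>\<Psi> J (a * b) * \<theta> b\<close> is
      \<theta>(a) \<theta>(b)^2 = \<theta>(a). Exchanging a and b then gives
      \<open>S {} y\<close>.\<close>
    have "S J y = (\<Sum>(a, b)\<in>hyperbola y. (\<Psi> {} (a * b) / sqrt (a * b)) * \<theta> a)"
      unfolding S_def
    proof (intro sum.cong refl, clarify)
      fix a b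
      have "\<Psi> J (a * b) * \<theta> b = \<Psi> {} (a * b) * \<theta> a"
      proof (cases "coprime (a * b) M")
        case True
        then have "coprime b M" by simp
        from real_characterD(4)[OF \<theta> this] have "\<theta> b * \<theta> b = 1" by auto
        with True * show ?thesis by (simp add: \<Psi>_def real_characterD(2)[OF \<theta>] mult.assoc)
      qed (simp add: \<Psi>_def)
      then have "real_of_int (\<Psi> J (a * b)) * \<theta> b = real_of_int (\<Psi> {} (a * b)) * \<theta> a"
        by (simp flip: of_int_mult)
      then show "(\<Psi> J (a * b) / sqrt (a * b)) * \<theta> b = (\<Psi> {} (a * b) / sqrt (a * b)) * \<theta> a"
        by simp
    qed
    also have "\<dots> = S {} y"
      unfolding S_def by (rule sum.reindex_bij_witness[of _ prod.swap prod.swap])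
        (auto simp: hyperbola_def mult.commute)
    finally have "S J y = S {} y" .
    moreover have "e J = 1" using * by (simp add: e_def)
    moreover have "C \<ge> 0" by (simp add: C_def)
    ultimately show ?thesis using T[of y] by simp
  qed
  have "S {} y \<le> card (Pow P) * C" for y
  proof -
    have "(\<Sum>J\<in>Pow P. e J * S J y) =
        (\<Sum>J\<in>Pow P. \<Sum>v=1..y^2. ((\<Prod>i\<in>J. \<epsilon> i * \<psi> i v)) * (of_bool (coprime v M) / sqrt v * divisor_sum \<theta> v))"
      unfolding S \<Psi>_def e_def by (simp add: sum_distrib_left prod.distrib mult_ac)
    also have "\<dots> = (\<Sum>v=1..y^2. \<Sum>J\<in>Pow P. ((\<Prod>i\<in>J. \<epsilon> i * \<psi> i v)) * (of_bool (coprime v M) / sqrt v * divisor_sum \<theta> v))"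
      by (rule sum.swap)
    also have "\<dots> = (\<Sum>v=1..y^2. (\<Prod>i\<in>P. 1 + \<epsilon> i * \<psi> i v) * (of_bool (coprime v M) / sqrt v * divisor_sum \<theta> v))"
      by (simp add: prod_one_plus[OF P] sum_distrib_right sum_divide_distrib of_int_sum)
    \<comment> \<open>By the assumption to be refuted, each v coprime to M with nonzero divisor sum
      has some i with \<open>\<psi> i v = - \<epsilon> i\<close>, so a factor of the product
      vanishes.\<close>
    also have "\<dots> = (\<Sum>v=1..y^2. 0)"
    proof (intro sum.cong refl)
      fix v assume v: "v \<in> {1..y^2}"
      show "(\<Prod>i\<in>P. 1 + \<epsilon> i * \<psi> i v) * (of_bool (coprime v M) / sqrt v * divisor_sum \<theta> v) = 0"
      proof (cases "coprime v M \<and> divisor_sum \<theta> v \<noteq> 0")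
        case True
        with contra v obtain i where i: "i \<in> P" "\<psi> i v \<noteq> \<epsilon> i" by fastforce
        have "coprime v M" using True by simp
        then have "1 + \<epsilon> i * \<psi> i v = 0"
          using \<epsilon>[OF i(1)] real_characterD(4)[OF \<psi>[OF i(1)], of v] i(2) by auto
        then have "(\<Prod>i\<in>P. 1 + \<epsilon> i * \<psi> i v) = 0" using i P by (meson prod_zero)
        then show ?thesis by simp
      qed auto
    qed
    finally have "(\<Sum>J\<in>Pow P. e J * S J y) = 0" by simp
    then have "S {} y = - (\<Sum>J\<in>Pow P - {{}}. e J * S J y)"
      using P by (simp add: sum.remove[of "Pow P" "{}"] e_def)
    also have "\<dots> = (\<Sum>J\<in>Pow P - {{}}. - (e J * S J y))" by (simp add: sum_negf)
    also have "\<dots> \<le> (\<Sum>J\<in>Pow P - {{}}. C)"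
    proof (rule sum_mono)
      fix J assume "J \<in> Pow P - {{}}"
      then show "- (e J * S J y) \<le> C" using lower[of J y] by auto
    qed
    also have "\<dots> \<le> (\<Sum>J\<in>Pow P. C)"
      using P by (intro sum_mono2) (auto simp: C_def)
    finally show ?thesis by simp
  qed
  moreover obtain y where "S {} y > card (Pow P) * C"
    using divisor_sum_diverges[OF \<theta>] unfolding S \<Psi>_def by fastforce
  ultimately show False by (metis not_less)
qed

section \<open>Legendre symbols\<close>

text \<open>The symbol (-1/v), written modulo 8 to share its modulus with
  \<open>chi8\<close>.\<close>

definition chi4 :: "nat \<Rightarrow> int" where
  "chi4 v = (if v mod 8 \<in> {1, 5} then 1 else if v mod 8 \<in> {3, 7} then -1 else 0)"

text \<open>The symbol (2/v) for odd v, extended by 0.\<close>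

definition chi8 :: "nat \<Rightarrow> int" where
  "chi8 v = (if v mod 8 \<in> {1, 7} then 1 else if v mod 8 \<in> {3, 5} then -1 else 0)"

section \<open>Characters modulo 8\<close>

lemma mod_8_cases:
  "(v::nat) mod 8 = 0 \<or> v mod 8 = 1 \<or> v mod 8 = 2 \<or> v mod 8 = 3 \<or>
    v mod 8 = 4 \<or> v mod 8 = 5 \<or> v mod 8 = 6 \<or> v mod 8 = 7"
  using mod_less_divisor[of 8 v] by linarith

lemma coprime_8_iff: "coprime (v::nat) 8 \<longleftrightarrow> odd v"
proof -
  have "coprime v (2 ^ 3) \<longleftrightarrow> odd v" by (subst coprime_power_right_iff) simp
  then show ?thesis by simp
qed

text \<open>The odd residues modulo 8 form a Klein four-group generated by 3 and 5, with 7 = 3 *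
  5.\<close>

lemma real_character_8I:
  assumes f: "\<And>v. f v = g (v mod 8)"
    and g: "g 0 = 0" "g 2 = 0" "g 4 = 0" "g 6 = 0" "g (Suc 0) = 1" "g 3 = 1 \<or> g 3 = -1" "g 5 = 1 \<or> g 5 = -1" "g 7 = g 3 * g 5"
  shows "real_character 8 f"
  unfolding real_character_def
proof (intro conjI allI impI)
  fix a b :: nat
  have even: "f v = 0" if "even v" for v
  proof -
    have "even (v mod 8)" using that by presburger
    then show ?thesis using mod_8_cases[of v] by (elim disjE; simp add: f g)
  qed
  have odd: "v mod 8 = 1 \<or> v mod 8 = 3 \<or> v mod 8 = 5 \<or> v mod 8 = 7" if "odd v" for v :: nat
    using that by presburger
  have g3: "g 3 * g 3 = 1" and g5: "g 5 * g 5 = 1" using g(6,7) by auto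
  show "f (a * b) = f a * f b"
  proof (cases "even a \<or> even b")
    case True
    then show ?thesis using even[of a] even[of b] even[of "a * b"] by auto
  next
    case False
    have ab: "a * b mod 8 = (a mod 8) * (b mod 8) mod 8" by (simp add: mod_mult_eq)
    have g35: "g 3 * (g 3 * x) = x" "g 5 * (g 5 * x) = x" for x
      using g3 g5 by (simp_all flip: mult.assoc)
    from False have "odd a" "odd b" by auto
    from odd[OF this(1)] odd[OF this(2)] show ?thesis
      unfolding f ab
      by (elim disjE; simp add: g(5,8) g3 g5 g35 mult_ac)
  qed
  show "f (a + 8) = f a" unfolding f by simp
  show "f a = 1 \<or> f a = -1" if "coprime a 8"
  proof -
    have "odd a" using that by (simp add: coprime_8_iff)
    from odd[OF this] g(6,7) show ?thesis by (elim disjE; simp add: f g)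
  qed
  show "f a = 0" if "\<not> coprime a 8"
    using even[of a] that by (simp add: coprime_8_iff)
qed simp

lemma real_character_chi4: "real_character 8 chi4"
  by (rule real_character_8I[of _ chi4]) (simp_all add: chi4_def)

lemma real_character_chi8: "real_character 8 chi8"
  by (rule real_character_8I[of _ chi8]) (simp_all add: chi8_def)

section \<open>Legendre symbols, supplementary laws and reciprocity\<close>

lemma Legendre_cong: "[a = b] (mod p) \<Longrightarrow> Legendre a p = Legendre b p"
  by (simp add: Legendre_def QuadRes_def cong_def)

lemma Legendre_cases: "Legendre a p = 0 \<or> Legendre a p = 1 \<or> Legendre a p = -1"
  by (simp add: Legendre_def)

lemma Legendre_eq_0_iff: "Legendre a p = 0 \<longleftrightarrow> p dvd a"
  by (simp add: Legendre_def cong_0_iff)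

lemma QuadRes_if_Legendre_1: "Legendre a p = 1 \<Longrightarrow> QuadRes p a"
  by (simp add: Legendre_def split: if_splits)

text \<open>The two values differ by at most 2 < p. This turns Euler's criterion into
  equalities.\<close>

lemma sign_eq_if_cong:
  fixes x y :: int
  assumes "p > 2" "[x = y] (mod int p)" "x = 0 \<or> x = 1 \<or> x = -1" "y = 0 \<or> y = 1 \<or> y = -1"
  shows "x = y"
proof -
  have "int p dvd x - y" using assms(2) by (simp add: cong_iff_dvd_diff)
  moreover have "\<bar>x - y\<bar> < int p" using assms(1,3,4) by auto
  ultimately show ?thesis using dvd_imp_le_int[of "x - y" "int p"] by linarith
qed

lemma Legendre_mult:
  assumes "prime p" "p > 2"
  shows "Legendre (a * b) (int p) = Legendre a p * Legendre b p"
proof (rule sign_eq_if_cong[OF assms(2)])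
  have "[Legendre (a * b) p = a ^ ((p - 1) div 2) * b ^ ((p - 1) div 2)] (mod p)"
    using euler_criterion[OF assms, of "a * b"] by (simp add: power_mult_distrib)
  also have "[a ^ ((p - 1) div 2) * b ^ ((p - 1) div 2) = Legendre a p * Legendre b p] (mod p)"
    using assms by (intro cong_mult cong_sym[OF euler_criterion])
  finally show "[Legendre (a * b) (int p) = Legendre a p * Legendre b p] (mod int p)" .
qed (use Legendre_cases[of "a * b" p] Legendre_cases[of a p] Legendre_cases[of b p] in auto)

lemma Legendre_1: "prime p \<Longrightarrow> Legendre 1 (int p) = 1"
  unfolding Legendre_def QuadRes_def
  by (auto simp: cong_0_iff zdvd1_eq dest: prime_gt_1_nat intro: exI[of _ 1])

lemma odd_prime_mod_8:
  assumes "prime p" "p > (2::nat)"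
  shows "p mod 8 \<in> {1, 3, 5, 7}"
proof -
  have "odd p" using assms prime_odd_nat by blast
  then have "odd (p mod 8)" by presburger
  then show ?thesis using mod_8_cases[of p] by (elim disjE; simp)
qed

lemma Legendre_minus_1:
  assumes "prime p" "p > 2"
  shows "Legendre (-1) (int p) = chi4 p"
proof -
  have "odd ((p - 1) div 2) \<longleftrightarrow> chi4 p = -1"
    using odd_prime_mod_8[OF assms] by (auto simp: chi4_def; presburger)
  moreover have "chi4 p = 1 \<or> chi4 p = -1"
    using odd_prime_mod_8[OF assms] by (auto simp: chi4_def)
  ultimately have "(-1) ^ ((p - 1) div 2) = chi4 p" by (auto simp: uminus_power_if)
  then have "[Legendre (-1) (int p) = chi4 p] (mod int p)"
    using euler_criterion[OF assms, of "-1"] by simp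
  then show ?thesis
    by (rule sign_eq_if_cong[OF assms(2)]) (use Legendre_cases in \<open>auto simp: chi4_def\<close>)
qed

text \<open>Gauss's lemma: with h = (p - 1) / 2 the numbers 2, 4, ..., 2 h are already reduced
  modulo p, and h - h div 2 of them exceed h.\<close>

lemma Legendre_2:
  assumes "prime p" "p > 2"
  shows "Legendre 2 (int p) = chi8 p"
proof -
  have "\<not> int p dvd 2" using zdvd_imp_le[of "int p" 2] assms by auto
  then interpret G: GAUSS p 2
    using assms by unfold_locales (simp_all add: cong_0_iff)
  define h where "h = (int p - 1) div 2"
  have h: "int p = 2 * h + 1" using G.p_eq2 by (simp add: h_def)
  have "G.C = (\<lambda>x. x * 2) ` {0<..h}"
    unfolding G.C_def G.B_def G.A_def h_def[symmetric] image_image using h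
    by (intro image_cong refl) (auto intro: mod_pos_pos_trivial)
  then have "G.E = (\<lambda>x. x * 2) ` {h div 2<..h}"
    unfolding G.E_def h_def[symmetric] using h by auto
  then have "card G.E = nat (h - h div 2)"
    by (simp add: card_image inj_on_def)
  then have L: "Legendre 2 p = (-1) ^ nat (h - h div 2)" using G.gauss_lemma by simp
  define k where "k = p div 8"
  have p: "p = 8 * k + p mod 8" by (simp add: k_def)
  consider "p mod 8 = 1" | "p mod 8 = 3" | "p mod 8 = 5" | "p mod 8 = 7"
    using odd_prime_mod_8[OF assms] by auto
  then show ?thesis
  proof cases
    case 1
    then have "h = 4 * int k" using p h by linarith
    then have "nat (h - h div 2) = 2 * k" by simp
    then show ?thesis using L 1 by (simp add: chi8_def)
  next
    case 2
    then have "h = 4 * int k + 1" using p h by linarith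
    then have "nat (h - h div 2) = 2 * k + 1" by simp
    then show ?thesis using L 2 by (simp add: chi8_def)
  next
    case 3
    then have "h = 4 * int k + 2" using p h by linarith
    then have "nat (h - h div 2) = 2 * k + 1" by simp
    then show ?thesis using L 3 by (simp add: chi8_def)
  next
    case 4
    then have "h = 4 * int k + 3" using p h by linarith
    then have "nat (h - h div 2) = 2 * (k + 1)" by simp
    then show ?thesis using L 4 by (simp add: chi8_def)
  qed
qed

lemma real_character_Legendre:
  assumes "prime p" "p > 2"
  shows "real_character p (\<lambda>v. Legendre (int v) (int p))"
  unfolding real_character_def
proof (intro conjI allI impI)
  fix a b
  show "p > 0" using assms by simp
  show "Legendre (int (a * b)) (int p) = Legendre (int a) (int p) * Legendre (int b) (int p)"
    using Legendre_mult[OF assms] by simp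
  show "Legendre (int (a + p)) (int p) = Legendre (int a) (int p)"
    by (rule Legendre_cong) (simp add: cong_def)
  have "coprime a p \<longleftrightarrow> \<not> p dvd a" using assms(1)
    by (metis coprime_absorb_right coprime_commute not_prime_unit prime_imp_coprime)
  then show "coprime a p \<Longrightarrow> Legendre (int a) (int p) = 1 \<or> Legendre (int a) (int p) = -1"
    "\<not> coprime a p \<Longrightarrow> Legendre (int a) (int p) = 0"
    using Legendre_cases[of a p] Legendre_eq_0_iff[of a p] by auto
qed

text \<open>If every nonzero residue were a square, squaring would be onto and hence injective on 1,
  ..., p - 1, yet 1 and p - 1 have the same square.\<close>

lemma nonresidue_exists:
  assumes "prime p" "p > 2"
  shows "\<exists>x::nat. Legendre (int x) (int p) = -1"
proof (rule ccontr)
  assume contra: "\<not> ?thesis"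
  define s where "s x = x^2 mod p" for x :: nat
  have "{1..<p} \<subseteq> s ` {1..<p}"
  proof
    fix x assume x: "x \<in> {1..<p}"
    then have "\<not> int p dvd int x" by (auto dest: dvd_imp_le)
    then have "Legendre x p = 1" using contra Legendre_cases[of x p] Legendre_eq_0_iff[of x p] by auto
    then obtain y where y: "[y^2 = int x] (mod p)"
      using QuadRes_if_Legendre_1 unfolding QuadRes_def by blast
    define z where "z = nat (y mod p)"
    have z: "int z = y mod p" using assms(2) by (simp add: z_def)
    then have "[int (z^2) = int x] (mod p)" using y by (simp add: cong_def power_mod)
    then have "z^2 mod p = x mod p" by (metis cong_def cong_int_iff)
    then have "s z = x" using x by (simp add: s_def)
    moreover have "int z < int p" unfolding z using assms(2) by (intro pos_mod_bound) simp
    moreover have "z \<noteq> 0"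
    proof
      assume "z = 0"
      with \<open>s z = x\<close> x show False by (simp add: s_def)
    qed
    ultimately show "x \<in> s ` {1..<p}" by (intro image_eqI[of _ _ z]) auto
  qed
  then have "inj_on s {1..<p}"
    by (intro finite_surj_inj) auto
  moreover have "s (p - 1) = s 1"
  proof -
    obtain r where r: "p = r + 2" using assms(2) less_imp_add_positive[of 2 p] by (auto simp: add.commute)
    have "(p - 1)^2 = 1 + r * p" unfolding r by (simp add: power2_eq_square)
    then show ?thesis by (simp only: s_def mod_mult_self1 power_one)
  qed
  ultimately have "p - 1 = 1" using assms(2) by (intro inj_onD[of s "{1..<p}" "p - 1" 1]) auto
  then show False using assms(2) by simp
qed

text \<open>Reciprocity one prime at a time. The second conjunct lets the induction combine the
  signs through the multiplicativity of \<open>chi4\<close>.\<close>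

lemma Legendre_prod_reciprocity:
  assumes "finite P" "\<And>p. p \<in> P \<Longrightarrow> prime p \<and> p > 2" "prime q" "q > 2" "q \<notin> P"
  shows "Legendre (int (\<Prod>P)) (int q) =
    (\<Prod>p\<in>P. Legendre (int q) (int p)) * (if chi4 q = -1 \<and> chi4 (\<Prod>P) = -1 then -1 else 1)
    \<and> (chi4 (\<Prod>P) = 1 \<or> chi4 (\<Prod>P) = -1)"
  using assms(1,2,5)
proof (induction P rule: finite_induct)
  case empty
  then show ?case using Legendre_1[OF assms(3)] by (simp add: chi4_def)
next
  case (insert p P)
  have p: "prime p" "p > 2" "p \<noteq> q" using insert by auto
  have c: "chi4 p = 1 \<or> chi4 p = -1" "chi4 q = 1 \<or> chi4 q = -1"
    using odd_prime_mod_8[OF p(1,2)] odd_prime_mod_8[OF assms(3,4)] by (auto simp: chi4_def)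
  have par: "odd ((r - 1) div 2) \<longleftrightarrow> chi4 r = -1" if "prime r" "r > 2" for r :: nat
    using odd_prime_mod_8[OF that] by (auto simp: chi4_def; presburger)
  have "Legendre p q * Legendre q p = (if chi4 q = -1 \<and> chi4 p = -1 then -1 else 1)"
    using Quadratic_Reciprocity[OF p(1,2) assms(3,4) p(3)] par[OF p(1,2)] par[OF assms(3,4)]
    by (auto simp: uminus_power_if)
  moreover have "Legendre q p \<noteq> 0"
    using primes_dvd_imp_eq[OF p(1) assms(3)] p(3) by (auto simp: Legendre_eq_0_iff)
  then have "Legendre q p * Legendre q p = 1" using Legendre_cases[of q p] by auto
  moreover have "Legendre p q = Legendre q p * (Legendre p q * Legendre q p)"
    using calculation(2) by (simp add: mult.left_commute)
  ultimately have L: "Legendre p q = Legendre q p * (if chi4 q = -1 \<and> chi4 p = -1 then -1 else 1)"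
    by simp
  have "chi4 (p * \<Prod>P) = chi4 p * chi4 (\<Prod>P)" by (rule real_characterD(2)[OF real_character_chi4])
  then show ?case
    using insert L c by (auto simp: Legendre_mult[OF assms(3,4)])
qed

lemma real_character_lift:
  assumes f: "real_character m f" and "m dvd M" "M > 0"
  shows "real_character M (\<lambda>v. of_bool (coprime v M) * f v)"
proof -
  have per: "f (a + M) = f a" for a
    using real_character_mod[OF f, of "a + M"] real_character_mod[OF f, of a] assms(2)
    by (metis mod_add_self2 mod_mod_cancel)
  note pr = real_character_principal[OF assms(3)]
  show ?thesis
    unfolding real_character_def
  proof (intro conjI allI impI)
    fix a b
    show "of_bool (coprime (a * b) M) * f (a * b) = of_bool (coprime a M) * f a * (of_bool (coprime b M) * f b)"
      by (simp add: real_characterD(2)[OF f])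
    show "of_bool (coprime (a + M) M) * f (a + M) = of_bool (coprime a M) * f a"
      using real_characterD(3)[OF pr] by (simp only: per)
    show "of_bool (coprime a M) * f a = 1 \<or> of_bool (coprime a M) * f a = -1" if "coprime a M"
    proof -
      have "coprime a m" using that assms(2) by (metis coprime_divisors dvd_refl)
      then show ?thesis using real_characterD(4)[OF f] that by simp
    qed
  qed (use assms in auto)
qed

text \<open>\<open>character_values_exist\<close> is applied to the characters (v/p) and to
  \<open>\<theta>\<close>, which is \<open>\<omega>\<close> times their product; a nonzero divisor
  sum forces \<theta>(q) = 1 at primes of odd exponent. If \<open>\<omega>\<close> never takes the
  value -1, \<open>\<theta>\<close> is the product over all of P, and the case J = P needs the
  product of the \<open>\<epsilon> p\<close> to be 1.\<close>

lemma split_value_exists: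
  fixes \<epsilon> :: "nat \<Rightarrow> int"
  assumes P: "finite P" "\<And>p. p \<in> P \<Longrightarrow> prime p \<and> p > 2" and \<omega>: "real_character 8 \<omega>"
    and \<epsilon>: "\<And>p. p \<in> P \<Longrightarrow> \<epsilon> p = 1 \<or> \<epsilon> p = -1"
    and compat: "(\<exists>u. \<omega> u = -1) \<or> (\<Prod>p\<in>P. \<epsilon> p) = 1"
  shows "\<exists>v>0. odd v \<and> (\<forall>p\<in>P. \<not> p dvd v \<and> Legendre (int v) (int p) = \<epsilon> p) \<and>
    (\<forall>q. prime q \<and> odd (multiplicity q v) \<longrightarrow> \<omega> q * (\<Prod>p\<in>P. Legendre (int q) (int p)) = 1)"
proof -
  define M where "M = 8 * \<Prod>P"
  have M0: "M > 0" unfolding M_def using P by (auto intro!: prod_pos simp: prime_gt_0_nat)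
  have "coprime v (\<Prod>P) \<longleftrightarrow> (\<forall>p\<in>P. \<not> p dvd v)" for v
  proof
    assume c: "coprime v (\<Prod>P)"
    show "\<forall>p\<in>P. \<not> p dvd v"
    proof
      fix p assume "p \<in> P"
      then have "p dvd \<Prod>P" "prime p" using P by auto
      with c show "\<not> p dvd v" using coprime_common_divisor[of v "\<Prod>P" p] by (auto dest: prime_gt_1_nat)
    qed
  next
    assume "\<forall>p\<in>P. \<not> p dvd v"
    then show "coprime v (\<Prod>P)"
      using P(2) by (intro prod_coprime_right) (auto intro: prime_imp_coprime simp: coprime_commute[of v])
  qed
  then have copM: "coprime v M \<longleftrightarrow> odd v \<and> (\<forall>p\<in>P. \<not> p dvd v)" for v
    unfolding M_def using coprime_8_iff[of v] by (simp only: coprime_mult_right_iff)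
  have L1: "Legendre (int v) (int p) = 1" if "p \<in> P" "[v = 1] (mod p)" for v p
    using Legendre_cong[of "int v" 1 "int p"] Legendre_1[of p] P(2)[OF that(1)] that(2)
    by (simp flip: cong_int_iff)
  have nd: "\<not> p dvd v" if "Legendre (int v) (int p) \<noteq> 0" for v p
    using that Legendre_eq_0_iff[of v p] by auto
  \<comment> \<open>By the Chinese remainder theorem the symbol at a single prime can be made -1
    while the others and the class modulo 8 stay 1.\<close>
  have NR: "\<exists>v. coprime v M \<and> v mod 8 = 1 \<and> (\<forall>q\<in>P. Legendre (int v) (int q) = (if q = p then -1 else 1))"
    if p: "p \<in> P" for p
  proof -
    obtain x :: nat where x: "Legendre (int x) (int p) = -1"
      using nonresidue_exists[of p] P(2)[OF p] by auto
    have "coprime p 8" using P(2)[OF p] prime_odd_nat by (simp add: coprime_8_iff)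
    moreover have "coprime p (\<Prod>(P - {p}))"
      using P(2) p by (intro prod_coprime_right) (auto intro: primes_coprime)
    ultimately have "coprime p (8 * \<Prod>(P - {p}))" by (simp only: coprime_mult_right_iff)
    then obtain v where v: "[v = x] (mod p)" "[v = 1] (mod 8 * \<Prod>(P - {p}))"
      using binary_chinese_remainder_nat by blast
    have v8: "[v = 1] (mod 8)" using v(2) by (rule cong_dvd_modulus_nat) simp
    have "[v = 1] (mod q)" if "q \<in> P" "q \<noteq> p" for q
    proof -
      have "q dvd \<Prod>(P - {p})" using that P(1) by (intro dvd_prodI) auto
      then show ?thesis using v(2) cong_dvd_modulus_nat dvd_mult by blast
    qed
    then have L: "\<forall>q\<in>P. Legendre (int v) (int q) = (if q = p then -1 else 1)"
      using L1 x Legendre_cong[of "int v" "int x" "int p"] v(1) by (simp add: cong_int_iff)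
    have "odd v" using v8 unfolding cong_def by presburger
    moreover have "\<forall>q\<in>P. \<not> q dvd v" using L nd by (metis one_neq_zero neg_equal_0_iff_equal)
    ultimately have "coprime v M" unfolding copM by blast
    with L v8 show ?thesis by (auto simp: cong_def)
  qed
  define \<psi> where "\<psi> p v = of_bool (coprime v M) * Legendre (int v) (int p)" for p v :: nat
  define \<theta> where "\<theta> v = (of_bool (coprime v M) * \<omega> v) * (of_bool (coprime v M) * (\<Prod>p\<in>P. \<psi> p v))" for v
  have \<psi>: "real_character M (\<psi> p)" if "p \<in> P" for p
    unfolding \<psi>_def
  proof (rule real_character_lift[OF real_character_Legendre])
    have "p dvd \<Prod>P" using that P(1) by (intro dvd_prodI) auto
    then show "p dvd M" unfolding M_def by (rule dvd_mult)
  qed (use P(2)[OF that] M0 in auto)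
  have \<theta>: "real_character M \<theta>"
    unfolding \<theta>_def using P(1) M0 \<psi>
    by (intro real_character_mult real_character_prod real_character_lift[OF \<omega>]) (auto simp: M_def)
  have prodNR: "(\<Prod>i\<in>J. \<psi> i v) = (if p \<in> J then -1 else 1)"
    if "J \<subseteq> P" "coprime v M" "\<forall>q\<in>P. Legendre (int v) (int q) = (if q = p then -1 else 1)" for J p v
  proof -
    have "(\<Prod>i\<in>J. \<psi> i v) = (\<Prod>i\<in>J. if i = p then -1 else 1)"
      using that by (intro prod.cong) (auto simp: \<psi>_def)
    also have "\<dots> = (if p \<in> J then -1 else 1)"
      using finite_subset[OF that(1) P(1)] by (simp add: prod.delta)
    finally show ?thesis .
  qed
  have indep: "((\<exists>v. coprime v M \<and> (\<Prod>i\<in>J. \<psi> i v) = -1) \<and> (\<exists>v. coprime v M \<and> (\<Prod>i\<in>J. \<psi> i v) * \<theta> v = -1))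
      \<or> ((\<forall>v. coprime v M \<longrightarrow> (\<Prod>i\<in>J. \<psi> i v) = \<theta> v) \<and> (\<Prod>i\<in>J. \<epsilon> i) = 1)"
    if J: "J \<subseteq> P" "J \<noteq> {}" for J
  proof -
    obtain p where p: "p \<in> J" using J by blast
    obtain v where v: "coprime v M" "\<forall>q\<in>P. Legendre (int v) (int q) = (if q = p then -1 else 1)"
      using NR p J by blast
    have A: "\<exists>v. coprime v M \<and> (\<Prod>i\<in>J. \<psi> i v) = -1"
      using prodNR[OF J(1) v] p v(1) by auto
    show ?thesis
    proof (cases "\<exists>u. \<omega> u = -1")
      case True
      then obtain u where u: "\<omega> u = -1" ..
      have "coprime (8::nat) (\<Prod>P)"
        using P(2) prime_odd_nat by (intro prod_coprime_right) (auto simp: coprime_commute[of 8] coprime_8_iff)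
      \<comment> \<open>Here \<open>\<omega>\<close> is -1 and every symbol is 1, so w separates
        \<open>\<theta>\<close> from the products of the symbols.\<close>
      then obtain w where w: "[w = u] (mod 8)" "[w = 1] (mod \<Prod>P)"
        using binary_chinese_remainder_nat by blast
      have "[w = 1] (mod q)" if "q \<in> P" for q
      proof -
        have "q dvd \<Prod>P" using that P(1) by (intro dvd_prodI) auto
        with w(2) show ?thesis by (rule cong_dvd_modulus_nat)
      qed
      then have L: "\<forall>q\<in>P. Legendre (int w) (int q) = 1" using L1 by blast
      have "\<omega> w = -1"
        using u w(1) real_character_mod[OF \<omega>, of w] real_character_mod[OF \<omega>, of u] by (simp add: cong_def)
      then have "coprime w 8" using real_characterD(5)[OF \<omega>, of w] by auto
      then have "coprime w M" unfolding copM coprime_8_iff using L nd by (metis one_neq_zero)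
      moreover have "(\<Prod>i\<in>K. \<psi> i w) = 1" if "K \<subseteq> P" for K
        using that L \<open>coprime w M\<close> by (intro prod.neutral) (auto simp: \<psi>_def)
      ultimately have "coprime w M \<and> (\<Prod>i\<in>J. \<psi> i w) * \<theta> w = -1"
        using \<open>\<omega> w = -1\<close> J(1) by (simp add: \<theta>_def)
      with A show ?thesis by blast
    next
      case False
      with compat have \<epsilon>1: "(\<Prod>p\<in>P. \<epsilon> p) = 1" by blast
      have \<omega>1: "\<omega> v = 1" if "coprime v M" for v
        using that False real_characterD(4)[OF \<omega>, of v] unfolding copM coprime_8_iff by blast
      show ?thesis
      proof (cases "J = P")
        case True
        then show ?thesis using \<epsilon>1 \<omega>1 by (simp add: \<theta>_def)
      next
        case False
        \<comment> \<open>A prime outside J flips the sign of \<open>\<theta>\<close> but not that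
          of the product over J.\<close>
        then obtain p where p: "p \<in> P" "p \<notin> J" using J by blast
        obtain v where v: "coprime v M" "\<forall>q\<in>P. Legendre (int v) (int q) = (if q = p then -1 else 1)"
          using NR p J by blast
        have "(\<Prod>i\<in>J. \<psi> i v) * \<theta> v = -1"
          using prodNR[OF J(1) v] prodNR[OF order.refl v] p v(1) \<omega>1 by (simp add: \<theta>_def)
        with A v(1) show ?thesis by blast
      qed
    qed
  qed
  obtain v where v: "v > 0" "coprime v M" "divisor_sum \<theta> v \<noteq> 0" "\<forall>p\<in>P. \<psi> p v = \<epsilon> p"
    using character_values_exist[OF P(1) \<psi> \<theta> \<epsilon> indep] by blast
  have "\<omega> q * (\<Prod>p\<in>P. Legendre (int q) (int p)) = 1" if q: "prime q" "odd (multiplicity q v)" for q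
  proof -
    have "q dvd v" using q(2) by (metis even_zero not_dvd_imp_multiplicity_0)
    then have cq: "coprime q M" using v(2) by (metis coprime_divisors dvd_refl)
    have "\<theta> q \<noteq> -1" by (rule divisor_sum_nonzero_imp_split[OF \<theta> v(1,3) q])
    then have "\<theta> q = 1" using real_characterD(4)[OF \<theta> cq] by blast
    then show ?thesis using cq by (simp add: \<theta>_def \<psi>_def)
  qed
  moreover have "odd v" "\<forall>p\<in>P. \<not> p dvd v \<and> Legendre (int v) (int p) = \<epsilon> p"
    using v(2,4) unfolding copM by (auto simp: \<psi>_def copM)
  ultimately show ?thesis using v(1) by blast
qed

text \<open>The Chinese remainder theorem, one prime at a time; squarefreeness makes that prime
  coprime to the cofactor.\<close>

lemma squarefree_quadratic_residue:
  assumes "squarefree (m::nat)" "\<And>p. prime p \<Longrightarrow> p dvd m \<Longrightarrow> QuadRes (int p) a"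
  shows "\<exists>x. int m dvd x^2 - a"
  using assms
proof (induction m rule: less_induct)
  case (less m)
  show ?case
  proof (cases "m = 1")
    case False
    then obtain p where p: "prime p" "p dvd m" using prime_factor_nat by blast
    then obtain k where m: "m = p * k" by blast
    have "m \<noteq> 0" using less.prems(1) by (metis not_squarefree_0)
    then have "k > 0" using m by auto
    have "\<not> p dvd k"
    proof
      assume "p dvd k"
      then have "p^2 dvd m" by (simp add: m power2_eq_square)
      then have "p dvd 1" using less.prems(1) squarefreeD by blast
      with p(1) show False by simp
    qed
    then have cop: "coprime (int p) (int k)" using p(1) by (simp add: prime_imp_coprime)
    have "k < m" using m prime_gt_1_nat[OF p(1)] \<open>k > 0\<close> by simp
    moreover have "squarefree k" using less.prems(1) squarefree_mono[of k m] m by auto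
    ultimately obtain y where y: "int k dvd y^2 - a"
      using less.IH[of k] less.prems(2) m by auto
    obtain z where z: "[z^2 = a] (mod int p)" using less.prems(2)[OF p] unfolding QuadRes_def by blast
    obtain x where x: "[x = z] (mod int p)" "[x = y] (mod int k)"
      using binary_chinese_remainder_int[OF cop] by blast
    have "[x^2 = a] (mod int p)" using cong_pow[OF x(1), of 2] z cong_trans by blast
    moreover have "[x^2 = a] (mod int k)"
      using cong_pow[OF x(2), of 2] y cong_trans by (metis cong_iff_dvd_diff)
    ultimately have "int p * int k dvd x^2 - a"
      using cop by (intro divides_mult) (auto simp: cong_iff_dvd_diff)
    then show ?thesis unfolding m by auto
  qed auto
qed

section \<open>Sums of three squares\<close>

lemma squarefree_eq_prod_primes:
  assumes "squarefree (n::nat)"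
  shows "n = \<Prod>(prime_factors n)"
proof -
  have "n \<noteq> 0" using assms by (metis not_squarefree_0)
  then have "n = (\<Prod>p\<in>prime_factors n. p ^ multiplicity p n)"
    by (intro prime_factorization_nat) simp
  also have "\<dots> = \<Prod>(prime_factors n)"
  proof (intro prod.cong refl)
    fix p assume p: "p \<in> prime_factors n"
    then have "multiplicity p n \<le> 1" "multiplicity p n > 0"
      using assms \<open>n \<noteq> 0\<close> squarefree_factorial_semiring''[of n]
      by (auto simp: prime_factors_multiplicity)
    then have "multiplicity p n = 1" by linarith
    then show "p ^ multiplicity p n = p" by simp
  qed
  finally show ?thesis .
qed

text \<open>U = k W with W the squarefree part of a split value v. An odd prime q of W has odd
  exponent in v, so (-n/q) = 1. For an odd prime p of n, (-U/p) = (-k/p) (W/p) is the square of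
  \<open>\<epsilon> p\<close>, hence 1. Combining the primes gives the hypotheses of
  \<open>sum_three_squares_of_residues\<close>.\<close>

lemma squarefree_sum_three_squares:
  assumes sf: "squarefree (n::nat)" and n7: "n mod 8 \<noteq> 7"
  shows "\<exists>x y z::int. int n = x^2 + y^2 + z^2"
proof -
  have n0: "n > 0" using sf by (metis not_squarefree_0 gr0I)
  define P where "P = {p \<in> prime_factors n. p > 2}"
  have P: "finite P" "\<And>p. p \<in> P \<Longrightarrow> prime p \<and> p > 2" by (auto simp: P_def)
  have primeP: "p = 2 \<or> p \<in> P" if "prime p" "p dvd n" for p
    using that n0 prime_ge_2_nat[of p] by (auto simp: P_def prime_factors_dvd)
  have pf: "p \<in> prime_factors n \<longleftrightarrow> p \<in> P \<or> (p = 2 \<and> even n)" for p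
    using primeP[of p] n0 by (auto simp: P_def in_prime_factors_iff)
  have n: "n = (if even n then 2 else 1) * \<Prod>P"
  proof (cases "even n")
    case True
    have "prime_factors n = insert 2 P" using True by (intro Set.set_eqI) (auto simp only: pf insert_iff)
    moreover have "2 \<notin> P" by (simp add: P_def)
    ultimately show ?thesis using True squarefree_eq_prod_primes[OF sf] P(1) by simp
  next
    case False
    then have "prime_factors n = P" by (intro Set.set_eqI) (simp only: pf simp_thms)
    then show ?thesis using False squarefree_eq_prod_primes[OF sf] by simp
  qed
  text \<open>The character \<open>\<omega>\<close> is made such that \<open>\<omega> q * (\<Prod>p\<in>P. Legendre q p) = Legendre (-n) q\<close>. It is
    principal exactly if \<open>n mod 4 = 3\<close>; then the values \<open>\<epsilon> p = Legendre (-k) p\<close> must have product 1,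
    which for \<open>n mod 8 = 3\<close> holds with \<open>k = 2\<close> but not with \<open>k = 1\<close>.\<close>
  define \<omega> where "\<omega> v = of_bool (coprime v 8) *
      ((if even n then chi8 v else 1) * (if chi4 (\<Prod>P) = 1 then chi4 v else 1))" for v
  have rp: "real_character 8 (\<lambda>a. of_bool (coprime a 8))" by (rule real_character_principal) simp
  note r4 = real_character_chi4 and r8 = real_character_chi8
  have \<omega>: "real_character 8 \<omega>"
    unfolding \<omega>_def
    using rp real_character_mult[OF rp r4] real_character_mult[OF rp r8]
      real_character_mult[OF rp real_character_mult[OF r8 r4]]
    by (cases "even n"; cases "chi4 (\<Prod>P) = 1") simp_all
  have recip: "Legendre (- int n) (int q) = \<omega> q * (\<Prod>p\<in>P. Legendre (int q) (int p))"
    if q: "prime q" "q > 2" "q \<notin> P" for q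
  proof -
    note mult = Legendre_mult[OF q(1,2)]
    have "coprime q 8" using q prime_odd_nat by (simp add: coprime_8_iff)
    have c: "chi4 q = 1 \<or> chi4 q = -1" using odd_prime_mod_8[OF q(1,2)] by (auto simp: chi4_def)
    have "Legendre (- int n) q = Legendre (-1) q * (Legendre (if even n then 2 else 1) q * Legendre (\<Prod>P) q)"
      by (subst n) (simp flip: mult)
    also have "\<dots> = chi4 q * ((if even n then chi8 q else 1) * Legendre (\<Prod>P) q)"
      using Legendre_minus_1[OF q(1,2)] Legendre_2[OF q(1,2)] Legendre_1[OF q(1)] by simp
    finally show ?thesis
      using Legendre_prod_reciprocity[OF P q] c \<open>coprime q 8\<close> by (auto simp: \<omega>_def)
  qed
  define k :: nat where "k = (if n mod 8 = 3 then 2 else 1)"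
  define \<epsilon> where "\<epsilon> p = Legendre (- int k) (int p)" for p :: nat
  have \<epsilon>: "\<epsilon> p = 1 \<or> \<epsilon> p = -1" if "p \<in> P" for p
  proof -
    have "\<not> int p dvd - int k"
      using P(2)[OF that] zdvd_imp_le[of "int p" "int k"] by (auto simp: k_def split: if_splits)
    then show ?thesis using Legendre_cases Legendre_eq_0_iff unfolding \<epsilon>_def by blast
  qed
  have compat: "(\<exists>u. \<omega> u = -1) \<or> (\<Prod>p\<in>P. \<epsilon> p) = 1"
  proof (cases "n mod 8 = 3")
    case True
    then have "odd n" by presburger
    then have nP: "n = \<Prod>P" using n by simp
    have mult: "f (\<Prod>P) = (\<Prod>p\<in>P. f p)" if "real_character 8 f" for f
      using P(1) by (induction P rule: finite_induct)
        (use real_character_1[OF that] real_characterD(2)[OF that] in auto)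
    \<comment> \<open>(-2/p) is a character value modulo 8, so the product is the value at n, which
      is (-1) (-1) for n = 3 modulo 8.\<close>
    have "(\<Prod>p\<in>P. \<epsilon> p) = (\<Prod>p\<in>P. chi4 p * chi8 p)"
    proof (intro prod.cong refl)
      fix p assume "p \<in> P"
      then have p: "prime p" "p > 2" using P by auto
      show "\<epsilon> p = chi4 p * chi8 p"
        using Legendre_mult[OF p, of "-1" 2] Legendre_minus_1[OF p] Legendre_2[OF p] True
        by (simp add: \<epsilon>_def k_def)
    qed
    also have "\<dots> = chi4 n * chi8 n" using mult[OF r4] mult[OF r8] nP by (simp add: prod.distrib)
    also have "\<dots> = 1" using True by (simp add: chi4_def chi8_def)
    finally show ?thesis by blast
  next
    case False
    show ?thesis
    proof (cases "even n")
      case True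
      \<comment> \<open>At 5 \<open>chi8\<close> is -1 and \<open>chi4\<close> is 1, so the sign
        does not depend on whether \<open>chi4\<close> occurs in \<open>\<omega>\<close>.\<close>
      then have "\<omega> 5 = -1" by (simp add: \<omega>_def chi4_def chi8_def coprime_8_iff)
      then show ?thesis by blast
    next
      case odd: False
      have "n mod 8 = 1 \<or> n mod 8 = 5" using odd False n7 by presburger
      then have "chi4 (\<Prod>P) = 1" using n odd by (auto simp: chi4_def)
      then have "\<omega> 3 = -1" using odd by (simp add: \<omega>_def chi4_def coprime_8_iff)
      then show ?thesis by blast
    qed
  qed
  obtain v where v: "v > 0" "odd v" "\<And>p. p \<in> P \<Longrightarrow> \<not> p dvd v \<and> Legendre (int v) (int p) = \<epsilon> p"
    and split: "\<And>q. prime q \<Longrightarrow> odd (multiplicity q v) \<Longrightarrow> \<omega> q * (\<Prod>p\<in>P. Legendre (int q) (int p)) = 1"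
    using split_value_exists[OF P \<omega> \<epsilon> compat] by blast
  \<comment> \<open>Removing the square keeps the symbols at the primes of P, which do not divide v,
    and leaves only primes of odd exponent.\<close>
  define W where "W = squarefree_part v"
  define w where "w = square_part v"
  have vW: "v = W * w^2" unfolding W_def w_def by (rule squarefree_decompose)
  have "odd W" using v(2) vW by auto
  define U where "U = k * W"
  have sfU: "squarefree U"
  proof (cases "n mod 8 = 3")
    case True
    have "coprime 2 W" using \<open>odd W\<close> by simp
    then show ?thesis unfolding U_def k_def W_def using True squarefree_prime[of "2::nat"]
      by (simp add: squarefree_mult_coprime)
  qed (simp add: U_def k_def W_def)
  \<comment> \<open>Every integer is congruent to its own square modulo 2, so the prime 2 imposes no
    condition.\<close>
  have qr2: "QuadRes (int 2) a" for a
    unfolding QuadRes_def by (intro exI[of _ a]) (simp add: cong_iff_dvd_diff power2_eq_square)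
  have qU: "q = 2 \<or> (q dvd W \<and> q > 2 \<and> q \<notin> P)" if "prime q" "q dvd U" for q
  proof (cases "q = 2")
    case False
    then have "q > 2" using prime_ge_2_nat[OF that(1)] by simp
    have "\<not> q dvd k" using \<open>q > 2\<close> by (auto simp: k_def dest: dvd_imp_le)
    then have "q dvd W" using that unfolding U_def by (simp add: prime_dvd_mult_iff)
    then have "q dvd v" using vW by simp
    with v(3) \<open>q > 2\<close> \<open>q dvd W\<close> show ?thesis by blast
  qed simp
  have "QuadRes (int q) (- int n)" if "prime q" "q dvd U" for q
    using qU[OF that]
  proof
    assume q: "q dvd W \<and> q > 2 \<and> q \<notin> P"
    then have "multiplicity q W > 0"
      using that(1) \<open>odd W\<close> by (simp add: prime_multiplicity_gt_zero_iff odd_pos)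
    then have "odd (multiplicity q v)"
      using prime_multiplicity_squarefree_part[OF that(1), of v] by (simp add: W_def odd_iff_mod_2_eq_one)
    then have "Legendre (- int n) (int q) = 1" using split[OF that(1)] recip[OF that(1)] q by simp
    then show ?thesis by (rule QuadRes_if_Legendre_1)
  qed (use qr2 in simp)
  then obtain C where C: "int U dvd C^2 - (- int n)"
    using squarefree_quadratic_residue[OF sfU] by blast
  have "QuadRes (int p) (- int U)" if "prime p" "p dvd n" for p
    using primeP[OF that]
  proof
    assume p: "p \<in> P"
    note mult = Legendre_mult[OF P(2)[OF p, THEN conjunct1] P(2)[OF p, THEN conjunct2]]
    have "\<not> p dvd w" using v(3)[OF p] vW by (auto simp: power2_eq_square)
    then have "Legendre (int w) p * Legendre (int w) p = 1"
      using Legendre_cases[of w p] Legendre_eq_0_iff[of w p] by auto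
    then have "Legendre (int W) p = Legendre (int v) p"
      unfolding vW by (simp add: mult power2_eq_square)
    then have "Legendre (int W) p = \<epsilon> p" using v(3)[OF p] by simp
    then have "Legendre (- int U) p = \<epsilon> p * \<epsilon> p"
      using mult[of "- int k" "int W"] by (simp add: U_def \<epsilon>_def)
    then have "Legendre (- int U) p = 1" using \<epsilon>[OF p] by auto
    then show ?thesis by (rule QuadRes_if_Legendre_1)
  qed (use qr2 in simp)
  then obtain \<alpha> where \<alpha>: "int n dvd \<alpha>^2 - (- int U)"
    using squarefree_quadratic_residue[OF sf] by blast
  \<comment> \<open>An odd common prime would lie in P and divide v. The prime 2 divides U only for
    k = 2, and then n is odd.\<close>
  have "coprime U n"
  proof (rule ccontr)
    assume "\<not> coprime U n"
    then have "gcd U n \<noteq> 1" by (simp only: coprime_iff_gcd_eq_1 not_False_eq_True)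
    then obtain q where "prime q" "q dvd gcd U n" using prime_factor_nat by blast
    then have q: "prime q" "q dvd U" "q dvd n" by (auto dest: dvd_trans)
    show False
    proof (cases "q = 2")
      case True
      with q have "even n" by simp
      then have "k = 1" unfolding k_def by presburger
      with q True \<open>odd W\<close> show False by (simp add: U_def)
    next
      case False
      with qU[OF q(1,2)] primeP[OF q(1,3)] show False by blast
    qed
  qed
  moreover have "U > 0" using \<open>odd W\<close> by (auto simp: U_def k_def odd_pos)
  ultimately show ?thesis
    using sum_three_squares_of_residues[of "int n" "int U" \<alpha> C] n0 \<alpha> C by simp
qed

text \<open>Write n = W w^2 with W squarefree. If W were 7 modulo 8 and w = 2^r u with u odd, then n
  = 4^r (W u^2) with W u^2 equal to 7 modulo 8, which is excluded. A representation of W is scaled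
  by w.\<close>

theorem sum_three_squares:
  assumes "\<not> (\<exists>r s. (n::nat) = 4 ^ r * (8 * s + 7))"
  shows "\<exists>x y z::int. int n = x^2 + y^2 + z^2"
proof (cases "n = 0")
  case True
  then show ?thesis by (intro exI[of _ 0]) simp
next
  case False
  define W w where "W = squarefree_part n" and "w = square_part n"
  have n: "n = W * w^2" unfolding W_def w_def by (rule squarefree_decompose)
  have "W mod 8 \<noteq> 7"
  proof
    assume W: "W mod 8 = 7"
    have "w \<noteq> 0" using n False by auto
    then obtain u where u: "w = 2 ^ multiplicity 2 w * u" "odd u"
      using multiplicity_decompose'[of w 2] by auto
    then obtain r where w: "w = 2 ^ r * u" by blast
    have "u mod 8 = 1 \<or> u mod 8 = 3 \<or> u mod 8 = 5 \<or> u mod 8 = 7" using u(2) by presburger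
    then have "u^2 mod 8 = 1" by (subst power_mod[symmetric]) (elim disjE; simp)
    then have "(W * u^2) mod 8 = 7" using W by (metis mod_mult_eq mult.right_neutral mod_mod_trivial)
    then have "W * u^2 = 8 * (W * u^2 div 8) + 7" by presburger
    moreover have "(2 ^ r)^2 = (4 ^ r :: nat)" by (simp flip: power_mult add: mult.commute[of r] power_mult)
    then have "n = 4 ^ r * (W * u^2)" unfolding n w(1) by (simp add: power_mult_distrib)
    ultimately show False using assms by metis
  qed
  then obtain x y z where "int W = x^2 + y^2 + z^2"
    using squarefree_sum_three_squares[of W] unfolding W_def by auto
  then have "int n = (int w * x)^2 + (int w * y)^2 + (int w * z)^2"
    by (simp add: n power_mult_distrib algebra_simps)
  then show ?thesis by blast
qed

theorem theorem2:
  fixes a b c d N :: int and m n :: nat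
  assumes N_def: "N = a^2 + b^2 + c^2 + d^2"
    and nonneg: "N * int m - int n ^ 4 \<ge> 0"
    and not_form: "\<not> (\<exists>r s :: nat. N * int m - int n ^ 4 = 4 ^ r * (8 * int s + 7))"
    and N_cases: "N \<in> {1, 3, 5, 7, 11, 15, 23} \<or>
      (\<exists>g :: nat. odd g \<and> (N = 2 ^ g \<or> N = 3 * 2 ^ g \<or> N = 7 * 2 ^ g))"
  shows "\<exists>x y z t :: int.
      int m = x^2 + y^2 + z^2 + t^2 \<and>
      int n ^ 2 = a * x + b * y + c * z + d * t"
proof -
  define k where "k = nat (N * int m - int n ^ 4)"
  have k: "int k = N * int m - int n ^ 4" using nonneg by (simp add: k_def)
  have "\<not> (\<exists>r s. k = 4 ^ r * (8 * s + 7))"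
  proof
    assume "\<exists>r s. k = 4 ^ r * (8 * s + 7)"
    then obtain r s where "k = 4 ^ r * (8 * s + 7)" by blast
    then have "int k = 4 ^ r * (8 * int s + 7)" by simp
    with k not_form show False by metis
  qed
  then obtain x y z where "int k = x^2 + y^2 + z^2" using sum_three_squares by blast
  \<comment> \<open>Reading n^4 as (n^2)^2 makes n^2 the real part of a quaternion of norm N
    m.\<close>
  then have "N * int m - (int n ^ 2)^2 = x^2 + y^2 + z^2" using k by simp
  then have "linear_value (int m) (int n ^ 2) a b c d"
    using linear_value_of_three_squares admissible_norm[OF N_cases] N_def by blast
  then show ?thesis unfolding linear_value_def .
qed

end
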